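(* Let $X, Z\in\mathbb{R}^{p_1\times p_2}$, $\hat X = X+Z$, and let $r$ be an integer with $1\le r\le \min(p_1,p_2)$. Let $U\in\mathbb{O}_{p_1,r}$, $V\in\mathbb{O}_{p_2,r}$ be leading $r$ left and right singular vectors of $X$, with orthogonal complements $U_\perp, V_\perp$, and let $\hat U\in\mathbb{O}_{p_1,r}$, $\hat V\in\mathbb{O}_{p_2,r}$ be leading $r$ left and right singular vectors of $\hat X$ (see context). Put $Z_{12} = \mathbb{P}_{U} Z \mathbb{P}_{V_\perp}$, $Z_{21} = \mathbb{P}_{U_\perp} Z\mathbb{P}_V$, $z_{12} = \|Z_{12}\|$, $z_{21}=\|Z_{21}\|$, and $$\alpha := \sigma_{\min}(U^{\top}\hat X V),\qquad \beta := \|U_\perp^{\top}\hat X V_\perp\|.$$ If $\alpha^2 > \beta^2 + \min(z_{12}^2, z_{21}^2)$, then $$\|\sin\Theta(V,\hat V)\| \le \min\left\{\frac{\alpha z_{12}+\beta z_{21}}{\alpha^2-\beta^2-\min(z_{21}^2, z_{12}^2)},\,1\right\},\qquad \|\sin\Theta(V,\hat V)\|_F \le \min\left\{\frac{\alpha \|Z_{12}\|_F+\beta \|Z_{21}\|_F}{\alpha^2-\beta^2-\min(z_{21}^2, z_{12}^2)},\,\sqrt r\right\},$$ $$\|\sin\Theta(U,\hat U)\| \le \min\left\{\frac{\alpha z_{21}+\beta z_{12}}{\alpha^2-\beta^2-\min(z_{21}^2, z_{12}^2)},\,1\right\},\qquad \|\sin\Theta(U,\hat U)\|_F \le \min\left\{\frac{\alpha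 \|Z_{21}\|_F+\beta \|Z_{12}\|_F}{\alpha^2-\beta^2-\min(z_{21}^2, z_{12}^2)},\,\sqrt r\right\}.$$
   Context: Notation: $\mathbb{O}_{p,r}=\{V\in\mathbb{R}^{p\times r}: V^\top V=I_r\}$, $\mathbb{O}_p=\mathbb{O}_{p,p}$. $\sigma_1(A)\ge\sigma_2(A)\ge\cdots\ge 0$ are the singular values of $A$; for $A\in\mathbb{R}^{p_1\times p_2}$, $\sigma_{\min}(A)=\sigma_{\min(p_1,p_2)}(A)$. $\|\cdot\|$ is the spectral norm, $\|\cdot\|_F$ the Frobenius norm. $\mathbb{P}_A$ is the orthogonal projection onto the column space of $A$. Singular value decompositions: $$X = [U\ U_\perp]\begin{bmatrix} \Sigma_1 & 0 \\ 0 & \Sigma_2 \end{bmatrix}\begin{bmatrix} V^\top \\ {V_\perp^\top} \end{bmatrix},\qquad \hat X = [\hat U\ \hat U_\perp]\begin{bmatrix} \hat\Sigma_1 & 0 \\ 0 & \hat\Sigma_2 \end{bmatrix}\begin{bmatrix} \hat V^\top \\ {\hat V_\perp^\top} \end{bmatrix},$$ where $[U\ U_\perp],[\hat U\ \hat U_\perp]\in\mathbb{O}_{p_1}$, $[V\ V_\perp],[\hat V\ \hat V_\perp]\in\mathbb{O}_{p_2}$, $\Sigma_1=\mathrm{diag}(\sigma_1(X),\dots,\sigma_r(X))$, $\Sigma_2\in\mathbb{R}^{(p_1-r)\times(p_2-r)}$ is the rectangular diagonal matrix with diagonal $\sigma_{r+1}(X),\sigma_{r+2}(X),\dots$, and $\hat\Sigma_1,\hat\Sigma_2$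 are formed in the same way from the singular values of $\hat X$. For $V,\hat V\in\mathbb{O}_{p,r}$, let $\sigma_1\ge\cdots\ge\sigma_r\ge0$ be the singular values of $V^\top\hat V$; $\Theta(V,\hat V)=\mathrm{diag}(\cos^{-1}\sigma_1,\dots,\cos^{-1}\sigma_r)$ and $\sin\Theta(V,\hat V)$ is the diagonal matrix obtained by applying $\sin$ to its diagonal entries. *)

theory Defs
  imports
    Complex_Main
    "HOL-Library.Multiset"
    "HOL-Computational_Algebra.Polynomial"
    "Jordan_Normal_Form.Char_Poly"
    "Jordan_Normal_Form.VS_Connect"
begin

text \<open>The dimension-carrying matrices of \<^theory>\<open>Jordan_Normal_Form.Matrix\<close> are used because the
  complementary blocks have \<open>p - r\<close> columns, a number which depends on \<open>p\<close> and \<open>r\<close> and may be \<open>0\<close>.\<close>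

text \<open>The set of \<open>p \<times> r\<close> matrices with orthonormal columns. The predicate \<^const>\<open>orthogonal_mat\<close> of the
  library only asks for pairwise orthogonal nonzero columns, so it is not what is needed here.\<close>

definition ortho_cols :: "nat \<Rightarrow> nat \<Rightarrow> real mat set" where
  "ortho_cols p r = {V \<in> carrier_mat p r. transpose_mat V * V = 1\<^sub>m r}"

definition append_cols :: "'a :: zero mat \<Rightarrow> 'a mat \<Rightarrow> 'a mat" where
  "append_cols A B = four_block_mat A B (0\<^sub>m 0 (dim_col A)) (0\<^sub>m 0 (dim_col B))"

text \<open>The singular values of \<open>A\<close> in nonincreasing order: the square roots of the \<open>min p\<^sub>1 p\<^sub>2\<close> largest
  eigenvalues of \<open>A\<^sup>T A\<close>, repeated according to algebraic multiplicity. If \<open>p\<^sub>2 > p\<^sub>1\<close>, the eigenvalues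
  cut off are \<open>p\<^sub>2 - p\<^sub>1\<close> zeros. In \<open>sing_val A i\<close> the index \<open>i\<close> starts from \<open>1\<close>.\<close>

definition sing_vals :: "real mat \<Rightarrow> real list" where
  "sing_vals A = take (min (dim_row A) (dim_col A))
     (rev (sorted_list_of_multiset (image_mset sqrt (proots (char_poly (transpose_mat A * A))))))"

definition sing_val :: "real mat \<Rightarrow> nat \<Rightarrow> real" where
  "sing_val A i = sing_vals A ! (i - 1)"

definition sing_val_min :: "real mat \<Rightarrow> real" where
  "sing_val_min A = sing_val A (min (dim_row A) (dim_col A))"

definition vec_norm2 :: "real vec \<Rightarrow> real" where
  "vec_norm2 v = sqrt (scalar_prod v v)"

definition spectral_norm :: "real mat \<Rightarrow> real" where
  "spectral_norm A = Sup {vec_norm2 (A *\<^sub>v v) | v. v \<in> carrier_vec (dim_col A) \<and> vec_norm2 v \<le> 1}"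

definition frob_norm :: "real mat \<Rightarrow> real" where
  "frob_norm A = sqrt (\<Sum>i<dim_row A. \<Sum>j<dim_col A. (A $$ (i, j))\<^sup>2)"

text \<open>\<open>col_space_proj A\<close> is the matrix of the orthogonal projection onto the column space of \<open>A\<close>.\<close>

definition col_space_proj :: "real mat \<Rightarrow> real mat" where
  "col_space_proj A = (let n = dim_row A; C = vec_space.col_space n A in
     THE P. P \<in> carrier_mat n n \<and>
       (\<forall>x \<in> carrier_vec n. P *\<^sub>v x \<in> C \<and> (\<forall>y \<in> C. scalar_prod (x - P *\<^sub>v x) y = 0)))"

lemma col_space_proj_ortho_cols:
  assumes "A \<in> ortho_cols n k"
  shows "col_space_proj A = A * transpose_mat A"
proof -
  have A: "A \<in> carrier_mat n k" and AA: "transpose_mat A * A = 1\<^sub>m k"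
    using assms by (auto simp: ortho_cols_def)
  have At: "transpose_mat A \<in> carrier_mat k n" using A by simp
  have dr: "dim_row A = n" "dim_col A = k" using A by auto
  define C where "C = vec_space.col_space n A"
  interpret vec_space "TYPE(real)" n .
  have C: "C = {A *\<^sub>v x | x. x \<in> carrier_vec k}"
    unfolding C_def using col_space_eq[OF A] A by fastforce
  let ?P = "A * transpose_mat A"
  let ?Q = "\<lambda>P. P \<in> carrier_mat n n \<and>
       (\<forall>x \<in> carrier_vec n. P *\<^sub>v x \<in> C \<and> (\<forall>y \<in> C. scalar_prod (x - P *\<^sub>v x) y = 0))"
  have orth: "scalar_prod z (A *\<^sub>v w) = 0"
    if "z \<in> carrier_vec n" "w \<in> carrier_vec k" "transpose_mat A *\<^sub>v z = 0\<^sub>v k" for z w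
  proof -
    have "scalar_prod z (A *\<^sub>v w) = scalar_prod (transpose_mat A *\<^sub>v z) w"
      using transpose_vec_mult_scalar[OF A that(2,1)] by simp
    then show ?thesis using that by simp
  qed
  have Px: "?P *\<^sub>v x = A *\<^sub>v (transpose_mat A *\<^sub>v x)" if "x \<in> carrier_vec n" for x
    using assoc_mult_mat_vec[OF A At that] .
  have AtA: "transpose_mat A *\<^sub>v (A *\<^sub>v w) = w" if "w \<in> carrier_vec k" for w
    using assoc_mult_mat_vec[OF At A that] AA that by simp
  have Q: "?Q ?P"
  proof (intro conjI ballI)
    show "?P \<in> carrier_mat n n" using A by simp
    fix x :: "real vec" assume x: "x \<in> carrier_vec n"
    have w: "transpose_mat A *\<^sub>v x \<in> carrier_vec k" using mult_mat_vec_carrier[OF At x] .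
    show "?P *\<^sub>v x \<in> C" unfolding C Px[OF x] using w by blast
    fix y assume "y \<in> C"
    then obtain v where v: "v \<in> carrier_vec k" "y = A *\<^sub>v v" unfolding C by blast
    have z: "A *\<^sub>v (transpose_mat A *\<^sub>v x) \<in> carrier_vec n" using mult_mat_vec_carrier[OF A w] .
    have "transpose_mat A *\<^sub>v (x - ?P *\<^sub>v x) = 0\<^sub>v k"
      unfolding Px[OF x] using mult_minus_distrib_mat_vec[OF At x z] AtA[OF w] w by simp
    then show "scalar_prod (x - ?P *\<^sub>v x) y = 0"
      unfolding v(2) using orth v(1) x z Px[OF x] by (metis minus_carrier_vec)
  qed
  have "P = ?P" if P: "?Q P" for P
  proof -
    have "P *\<^sub>v x = ?P *\<^sub>v x" if x: "x \<in> carrier_vec n" for x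
    proof -
      obtain v where v: "v \<in> carrier_vec k" "P *\<^sub>v x = A *\<^sub>v v" using P x unfolding C by blast
      have c: "x - P *\<^sub>v x \<in> carrier_vec n" using P x by (meson minus_carrier_vec mult_mat_vec_carrier)
      define w where "w = transpose_mat A *\<^sub>v (x - P *\<^sub>v x)"
      have w: "w \<in> carrier_vec k" unfolding w_def using mult_mat_vec_carrier[OF At c] .
      have "scalar_prod w w = scalar_prod (x - P *\<^sub>v x) (A *\<^sub>v w)"
        using transpose_vec_mult_scalar[OF A w c] w_def by simp
      also have "\<dots> = 0" using P x w unfolding C by blast
      finally have "w = 0\<^sub>v k" using w conjugate_square_eq_0_vec[OF w] by simp
      moreover have "w = transpose_mat A *\<^sub>v x - v"
        unfolding w_def using mult_minus_distrib_mat_vec[OF At x] AtA[OF v(1)] v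
        by (metis A mult_mat_vec_carrier)
      ultimately have "transpose_mat A *\<^sub>v x = v"
        using v(1) mult_mat_vec_carrier[OF At x]
        by (metis eq_vecI carrier_vecD index_minus_vec(1) index_zero_vec(1) eq_iff_diff_eq_0)
      then show ?thesis using v(2) Px[OF x] by simp
    qed
    then have eq: "P *\<^sub>v unit_vec n j = ?P *\<^sub>v unit_vec n j" for j by simp
    have cP: "P \<in> carrier_mat n n" using P by blast
    have cA: "?P \<in> carrier_mat n n" using A by simp
    have "col P j = col ?P j" if "j < n" for j
      using eq[of j] col_mult2[OF cP one_carrier_mat that] col_mult2[OF cA one_carrier_mat that]
      by (metis cP cA col_one right_mult_one_mat that)
    then show ?thesis using cP cA by (intro mat_col_eqI) auto
  qed
  then have "(THE P. ?Q P) = ?P" using Q by (intro the_equality) blast+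
  then show ?thesis unfolding col_space_proj_def Let_def dr C_def by simp
qed

text \<open>\<open>sing_block m n k A\<close> is the \<open>m \<times> n\<close> rectangular diagonal matrix with diagonal
  \<open>\<sigma>\<^bsub>k+1\<^esub>(A), \<sigma>\<^bsub>k+2\<^esub>(A), \<dots>\<close>; matrix entries are indexed from \<open>0\<close>.\<close>

definition sing_block :: "nat \<Rightarrow> nat \<Rightarrow> nat \<Rightarrow> real mat \<Rightarrow> real mat" where
  "sing_block m n k A = Matrix.mat m n (\<lambda>(i, j). if i = j then sing_val A (k + i + 1) else 0)"

text \<open>A singular value decomposition of the \<open>p\<^sub>1 \<times> p\<^sub>2\<close> matrix \<open>X\<close>, split after the \<open>r\<close> leading singular
  values.\<close>

definition split_svd ::
  "nat \<Rightarrow> nat \<Rightarrow> nat \<Rightarrow> real mat \<Rightarrow> real mat \<Rightarrow> real mat \<Rightarrow> real mat \<Rightarrow> real mat \<Rightarrow> bool" where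
  "split_svd p1 p2 r X U Uperp V Vperp \<longleftrightarrow>
     X \<in> carrier_mat p1 p2 \<and>
     U \<in> carrier_mat p1 r \<and> Uperp \<in> carrier_mat p1 (p1 - r) \<and>
     V \<in> carrier_mat p2 r \<and> Vperp \<in> carrier_mat p2 (p2 - r) \<and>
     append_cols U Uperp \<in> ortho_cols p1 p1 \<and>
     append_cols V Vperp \<in> ortho_cols p2 p2 \<and>
     X = append_cols U Uperp *
         four_block_mat (sing_block r r 0 X) (0\<^sub>m r (p2 - r))
                        (0\<^sub>m (p1 - r) r) (sing_block (p1 - r) (p2 - r) r X) *
         (transpose_mat V @\<^sub>r transpose_mat Vperp)"

text \<open>The diagonal matrix \<open>sin \<Theta>(V, W)\<close> of the sines of the principal angles.\<close>

definition sin_Theta :: "real mat \<Rightarrow> real mat \<Rightarrow> real mat" where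
  "sin_Theta V W = mat_diag (dim_col V) (\<lambda>i. sin (arccos (sing_val (transpose_mat V * W) (i + 1))))"

end

theory Submission
  imports
    Defs
    "HOL-Analysis.L2_Norm"
    "HOL-Combinatorics.Permutations"
    "Jordan_Normal_Form.Spectral_Radius"
begin

text \<open>
  Write \<open>A\<close> for the perturbed matrix \<open>Xhat\<close> and consider it in the block coordinates given by
  \<open>[U Uperp]\<close> and \<open>[V Vperp]\<close>. Because \<open>X\<close> has no off-diagonal blocks there, the off-diagonal blocks
  \<open>U\<^sup>T A Vperp\<close> and \<open>Uperp\<^sup>T A V\<close> come from \<open>Z\<close> alone, and their norms are at most those of \<open>Z12\<close> and
  \<open>Z21\<close> (\<open>ideal_norm_off_diagonal_block_le\<close>). The sines of the principal angles are measured by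
  \<open>Q = Vperp\<^sup>T Vhat\<close> and \<open>T = Uperp\<^sup>T Uhat\<close> (\<open>sin_Theta_eq_norms\<close>).

  The singular vector equations \<open>A Vhat = Uhat S\<close> and \<open>A\<^sup>T Uhat = Vhat S\<close>, with \<open>S\<close> the diagonal matrix of
  the leading \<open>r\<close> singular values of \<open>A\<close>, couple \<open>Q\<close> and \<open>T\<close>:
  \<open>Q S = (U\<^sup>T A Vperp)\<^sup>T (U\<^sup>T Uhat) + (Uperp\<^sup>T A Vperp)\<^sup>T T\<close>, and likewise for \<open>T S\<close>. Every diagonal entry of
  \<open>S\<close> is at least \<open>\<alpha>\<close>, since compression to \<open>r \<times> r\<close> blocks does not increase the \<open>r\<close>-th singular value
  (\<open>sing_val_compression_le\<close>). Hence, with \<open>N\<close> the spectral or the Frobenius norm,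
  \<open>\<alpha> N(Q) \<le> N(Z12) + \<beta> N(T)\<close> and \<open>\<alpha> N(T) \<le> N(Z21) + \<beta> N(Q)\<close>; eliminating one of the unknowns gives
  \<open>(\<alpha>\<^sup>2 - \<beta>\<^sup>2) N(Q) \<le> \<alpha> N(Z12) + \<beta> N(Z21)\<close> and its mirror image (\<open>sine_bounds_ideal_norm\<close>). The denominators
  of the theorem are positive and at most \<open>\<alpha>\<^sup>2 - \<beta>\<^sup>2\<close>.

  Singular values are defined by roots of a characteristic polynomial. The bridge to norms of vectors is
  the spectral theorem for real symmetric matrices (\<open>real_spectral_theorem\<close>), which provides an
  orthonormal basis of right singular vectors ordered by singular value (\<open>right_singular_system_exists\<close>).
\<close>

section \<open>Euclidean norm\<close>

lemma vec_norm2_L2: "vec_norm2 v = L2_set (\<lambda>i. v $ i) {0..<dim_vec v}"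
  by (simp add: vec_norm2_def scalar_prod_def L2_set_def power2_eq_square)

lemma vec_norm2_nonneg [simp]: "0 \<le> vec_norm2 v"
  by (simp add: vec_norm2_L2)

lemma vec_norm2_sq: "(vec_norm2 v)\<^sup>2 = v \<bullet> v"
  by (simp add: vec_norm2_def scalar_prod_def sum_nonneg)

lemma vec_norm2_zero [simp]: "vec_norm2 (0\<^sub>v n) = 0"
  by (simp add: vec_norm2_def)

lemma vec_norm2_smult: "vec_norm2 (c \<cdot>\<^sub>v v) = \<bar>c\<bar> * vec_norm2 v"
proof -
  have "(c \<cdot>\<^sub>v v) \<bullet> (c \<cdot>\<^sub>v v) = c\<^sup>2 * (v \<bullet> v)" by (simp add: power2_eq_square)
  then show ?thesis by (simp add: vec_norm2_def real_sqrt_mult)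
qed

lemma vec_norm2_add_le:
  assumes "v \<in> carrier_vec n" "w \<in> carrier_vec n"
  shows "vec_norm2 (v + w) \<le> vec_norm2 v + vec_norm2 w"
proof -
  have "vec_norm2 (v + w) = L2_set (\<lambda>i. v $ i + w $ i) {0..<n}"
    unfolding vec_norm2_L2 using assms by (intro L2_set_cong) auto
  also have "\<dots> \<le> L2_set (\<lambda>i. v $ i) {0..<n} + L2_set (\<lambda>i. w $ i) {0..<n}"
    by (rule L2_set_triangle_ineq)
  finally show ?thesis using assms by (simp add: vec_norm2_L2)
qed

lemma abs_scalar_prod_le_vec_norm2:
  assumes "v \<in> carrier_vec n" "w \<in> carrier_vec n"
  shows "\<bar>v \<bullet> w\<bar> \<le> vec_norm2 v * vec_norm2 w"
proof -
  have "\<bar>v \<bullet> w\<bar> \<le> (\<Sum>i\<in>{0..<n}. \<bar>v $ i\<bar> * \<bar>w $ i\<bar>)"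
    unfolding scalar_prod_def using assms sum_abs[of "\<lambda>i. v $ i * w $ i" "{0..<n}"]
    by (simp add: abs_mult)
  also have "\<dots> \<le> L2_set (\<lambda>i. v $ i) {0..<n} * L2_set (\<lambda>i. w $ i) {0..<n}"
    by (rule L2_set_mult_ineq)
  finally show ?thesis using assms by (simp add: vec_norm2_L2)
qed

lemma scalar_prod_mult_mat_vec:
  fixes A :: "real mat"
  assumes "A \<in> carrier_mat m n" "v \<in> carrier_vec n" "w \<in> carrier_vec m"
  shows "(A *\<^sub>v v) \<bullet> w = v \<bullet> (A\<^sup>T *\<^sub>v w)"
  using transpose_vec_mult_scalar[OF assms] assms
  by (metis comm_scalar_prod mult_mat_vec_carrier transpose_carrier_mat)

lemma ortho_colsD:
  assumes "V \<in> ortho_cols p r"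
  shows "V \<in> carrier_mat p r" "V\<^sup>T \<in> carrier_mat r p" "V\<^sup>T * V = 1\<^sub>m r"
  using assms by (auto simp: ortho_cols_def)

lemma vec_norm2_ortho_cols_mult:
  assumes V: "V \<in> ortho_cols p r" and w: "w \<in> carrier_vec r"
  shows "vec_norm2 (V *\<^sub>v w) = vec_norm2 w"
proof -
  note V = ortho_colsD[OF V]
  have "(V *\<^sub>v w) \<bullet> (V *\<^sub>v w) = w \<bullet> (V\<^sup>T *\<^sub>v (V *\<^sub>v w))"
    by (rule scalar_prod_mult_mat_vec[OF V(1) w mult_mat_vec_carrier[OF V(1) w]])
  also have "\<dots> = w \<bullet> w"
    using V(3) w by (simp add: assoc_mult_mat_vec[OF V(2,1) w, symmetric])
  finally show ?thesis by (simp add: vec_norm2_def)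
qed

section \<open>Spectral and Frobenius norm\<close>

lemma frob_norm_nonneg [simp]: "0 \<le> frob_norm A"
  by (simp add: frob_norm_def sum_nonneg)

lemma frob_norm_sq: "(frob_norm A)\<^sup>2 = (\<Sum>i<dim_row A. \<Sum>j<dim_col A. (A $$ (i, j))\<^sup>2)"
  by (simp add: frob_norm_def sum_nonneg)

lemma frob_norm_sq_rows: "(frob_norm A)\<^sup>2 = (\<Sum>i<dim_row A. (vec_norm2 (row A i))\<^sup>2)"
  unfolding frob_norm_sq vec_norm2_sq scalar_prod_def
  by (auto intro!: sum.cong simp: power2_eq_square atLeast0LessThan)

lemma frob_norm_sq_cols: "(frob_norm A)\<^sup>2 = (\<Sum>j<dim_col A. (vec_norm2 (col A j))\<^sup>2)"
  unfolding frob_norm_sq vec_norm2_sq scalar_prod_def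
  by (subst sum.swap) (auto intro!: sum.cong simp: power2_eq_square atLeast0LessThan)

text \<open>The supremum that defines the spectral norm is taken over a bounded set, because the Frobenius
  norm is an upper bound for it (Cauchy--Schwarz, row by row).\<close>

lemma vec_norm2_mult_le_frob:
  assumes A: "A \<in> carrier_mat m n" and v: "v \<in> carrier_vec n"
  shows "vec_norm2 (A *\<^sub>v v) \<le> frob_norm A * vec_norm2 v"
proof (rule power2_le_imp_le)
  have "(vec_norm2 (A *\<^sub>v v))\<^sup>2 = (\<Sum>i<m. (row A i \<bullet> v)\<^sup>2)"
    unfolding vec_norm2_sq scalar_prod_def[of "A *\<^sub>v v"] using A
    by (auto simp: power2_eq_square atLeast0LessThan intro!: sum.cong)
  also have "\<dots> \<le> (\<Sum>i<m. (vec_norm2 (row A i) * vec_norm2 v)\<^sup>2)"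
  proof (rule sum_mono)
    fix i assume i: "i \<in> {..<m}"
    have r: "row A i \<in> carrier_vec n" using A i by auto
    have "\<bar>row A i \<bullet> v\<bar> \<le> vec_norm2 (row A i) * vec_norm2 v"
      by (rule abs_scalar_prod_le_vec_norm2[OF r v])
    then show "(row A i \<bullet> v)\<^sup>2 \<le> (vec_norm2 (row A i) * vec_norm2 v)\<^sup>2"
      by (metis abs_ge_zero power2_abs power_mono)
  qed
  also have "\<dots> = (frob_norm A * vec_norm2 v)\<^sup>2"
    using A by (simp add: frob_norm_sq_rows power_mult_distrib sum_distrib_right)
  finally show "(vec_norm2 (A *\<^sub>v v))\<^sup>2 \<le> (frob_norm A * vec_norm2 v)\<^sup>2" .
qed simp

lemma spectral_norm_bdd_above: "bdd_above {vec_norm2 (A *\<^sub>v v) | v. v \<in> carrier_vec (dim_col A) \<and> vec_norm2 v \<le> 1}"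
proof (rule bdd_aboveI[of _ "frob_norm A"], clarify)
  fix w :: "real vec" assume w: "w \<in> carrier_vec (dim_col A)" "vec_norm2 w \<le> 1"
  have "vec_norm2 (A *\<^sub>v w) \<le> frob_norm A * vec_norm2 w"
    by (rule vec_norm2_mult_le_frob[of A "dim_row A"]) (use w in auto)
  also have "\<dots> \<le> frob_norm A * 1" using w by (intro mult_left_mono) auto
  finally show "vec_norm2 (A *\<^sub>v w) \<le> frob_norm A" by simp
qed

lemma vec_norm2_mult_le_spectral:
  assumes A: "A \<in> carrier_mat m n" and v: "v \<in> carrier_vec n"
  shows "vec_norm2 (A *\<^sub>v v) \<le> spectral_norm A * vec_norm2 v"
proof (cases "vec_norm2 v = 0")
  case True
  then show ?thesis using vec_norm2_mult_le_frob[OF A v] by simp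
next
  case False
  define c where "c = vec_norm2 v"
  define u where "u = (1 / c) \<cdot>\<^sub>v v"
  have c: "c > 0" using False by (metis c_def less_le vec_norm2_nonneg)
  have u: "u \<in> carrier_vec n" "vec_norm2 u = 1" using v c by (auto simp: u_def vec_norm2_smult c_def)
  have "v = c \<cdot>\<^sub>v u" using c by (simp add: u_def smult_smult_assoc)
  then have "A *\<^sub>v v = c \<cdot>\<^sub>v (A *\<^sub>v u)" using mult_mat_vec[OF A u(1)] by simp
  then have "vec_norm2 (A *\<^sub>v v) = c * vec_norm2 (A *\<^sub>v u)" using c by (simp add: vec_norm2_smult)
  also have "vec_norm2 (A *\<^sub>v u) \<le> spectral_norm A"
    unfolding spectral_norm_def
  proof (rule cSup_upper)
    show "vec_norm2 (A *\<^sub>v u) \<in> {vec_norm2 (A *\<^sub>v v) | v. v \<in> carrier_vec (dim_col A) \<and> vec_norm2 v \<le> 1}"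
      using A u by auto
  qed (rule spectral_norm_bdd_above)
  finally show ?thesis using c by (simp add: c_def mult.commute)
qed

lemma spectral_norm_leI:
  assumes A: "A \<in> carrier_mat m n" and c: "0 \<le> c"
    and le: "\<And>v. v \<in> carrier_vec n \<Longrightarrow> vec_norm2 (A *\<^sub>v v) \<le> c * vec_norm2 v"
  shows "spectral_norm A \<le> c"
  unfolding spectral_norm_def
proof (rule cSup_least, goal_cases)
  case 1
  have "0\<^sub>v (dim_col A) \<in> carrier_vec (dim_col A)" "vec_norm2 (0\<^sub>v (dim_col A)) \<le> 1" by auto
  then show ?case by blast
next
  case (2 x)
  then obtain v where v: "v \<in> carrier_vec n" "vec_norm2 v \<le> 1" "x = vec_norm2 (A *\<^sub>v v)"
    using A by auto
  have "x \<le> c * vec_norm2 v" using le v by simp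
  also have "\<dots> \<le> c * 1" using v c by (intro mult_left_mono)
  finally show ?case by simp
qed

lemma spectral_norm_nonneg [simp]: "0 \<le> spectral_norm A"
proof -
  have "vec_norm2 (A *\<^sub>v 0\<^sub>v (dim_col A)) \<le> spectral_norm A"
    unfolding spectral_norm_def
    by (rule cSup_upper[OF _ spectral_norm_bdd_above]) (auto intro!: exI[of _ "0\<^sub>v (dim_col A)"])
  then show ?thesis using vec_norm2_nonneg order_trans by blast
qed

text \<open>The spectral and the Frobenius norm enter the perturbation argument only through these
  properties, so that the argument is carried out once for both. The ideal property for multiplication
  from the right follows by transposition.\<close>

definition ideal_norm :: "(real mat \<Rightarrow> real) \<Rightarrow> bool" where
  "ideal_norm N \<longleftrightarrow>
     (\<forall>A. 0 \<le> N A) \<and>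
     (\<forall>A. N (A\<^sup>T) = N A) \<and>
     (\<forall>m n A B. A \<in> carrier_mat m n \<longrightarrow> B \<in> carrier_mat m n \<longrightarrow> N (A + B) \<le> N A + N B) \<and>
     (\<forall>l m n A B. A \<in> carrier_mat l m \<longrightarrow> B \<in> carrier_mat m n \<longrightarrow> N (A * B) \<le> spectral_norm A * N B)"

text \<open>This is \<open>|A\<^sup>T v|\<^sup>2 = (A A\<^sup>T v) \<bullet> v \<le> \<parallel>A\<parallel> |A\<^sup>T v| |v|\<close>, divided by \<open>|A\<^sup>T v|\<close>.\<close>

lemma spectral_norm_transpose_le: "spectral_norm (A\<^sup>T) \<le> spectral_norm A"
proof (rule spectral_norm_leI)
  show "A\<^sup>T \<in> carrier_mat (dim_col A) (dim_row A)" by simp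
  fix v :: "real vec" assume v: "v \<in> carrier_vec (dim_row A)"
  let ?w = "A\<^sup>T *\<^sub>v v"
  have A: "A \<in> carrier_mat (dim_row A) (dim_col A)" by simp
  have w: "?w \<in> carrier_vec (dim_col A)" by (rule mult_mat_vec_carrier[OF _ v]) simp
  have "(vec_norm2 ?w)\<^sup>2 = (A *\<^sub>v ?w) \<bullet> v"
    unfolding vec_norm2_sq by (rule scalar_prod_mult_mat_vec[OF A w v, symmetric])
  also have "\<dots> \<le> vec_norm2 (A *\<^sub>v ?w) * vec_norm2 v"
    using abs_scalar_prod_le_vec_norm2[OF mult_mat_vec_carrier[OF A w] v] by linarith
  also have "\<dots> \<le> (spectral_norm A * vec_norm2 ?w) * vec_norm2 v"
    by (intro mult_right_mono vec_norm2_mult_le_spectral[OF A w]) simp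
  finally have "vec_norm2 ?w * vec_norm2 ?w \<le> (spectral_norm A * vec_norm2 v) * vec_norm2 ?w"
    by (simp add: power2_eq_square mult_ac)
  then show "vec_norm2 ?w \<le> spectral_norm A * vec_norm2 v"
    using vec_norm2_nonneg[of ?w] by (cases "vec_norm2 ?w = 0") (auto simp: mult_le_cancel_right)
qed simp

lemma ideal_norm_spectral: "ideal_norm spectral_norm"
  unfolding ideal_norm_def
proof (intro conjI allI impI)
  show "spectral_norm (A\<^sup>T) = spectral_norm A" for A
    using spectral_norm_transpose_le[of A] spectral_norm_transpose_le[of "A\<^sup>T"] by simp
  show "spectral_norm (A + B) \<le> spectral_norm A + spectral_norm B"
    if A: "A \<in> carrier_mat m n" and B: "B \<in> carrier_mat m n" for m n A B
  proof (rule spectral_norm_leI)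
    fix v :: "real vec" assume v: "v \<in> carrier_vec n"
    have "vec_norm2 ((A + B) *\<^sub>v v) \<le> vec_norm2 (A *\<^sub>v v) + vec_norm2 (B *\<^sub>v v)"
      unfolding add_mult_distrib_mat_vec[OF A B v]
      by (rule vec_norm2_add_le[of _ m]) (use A B v in auto)
    then show "vec_norm2 ((A + B) *\<^sub>v v) \<le> (spectral_norm A + spectral_norm B) * vec_norm2 v"
      using vec_norm2_mult_le_spectral[OF A v] vec_norm2_mult_le_spectral[OF B v]
      by (simp add: distrib_right)
  qed (use A B in auto)
  show "spectral_norm (A * B) \<le> spectral_norm A * spectral_norm B"
    if A: "A \<in> carrier_mat l m" and B: "B \<in> carrier_mat m n" for l m n A B
  proof (rule spectral_norm_leI)
    fix v :: "real vec" assume v: "v \<in> carrier_vec n"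
    have "vec_norm2 ((A * B) *\<^sub>v v) = vec_norm2 (A *\<^sub>v (B *\<^sub>v v))" using A B v by simp
    also have "\<dots> \<le> spectral_norm A * vec_norm2 (B *\<^sub>v v)"
      by (rule vec_norm2_mult_le_spectral[OF A]) (use B v in auto)
    also have "\<dots> \<le> spectral_norm A * (spectral_norm B * vec_norm2 v)"
      by (intro mult_left_mono vec_norm2_mult_le_spectral[OF B v]) simp
    finally show "vec_norm2 ((A * B) *\<^sub>v v) \<le> spectral_norm A * spectral_norm B * vec_norm2 v"
      by (simp add: mult_ac)
  qed (use A B in auto)
qed simp

lemma frob_norm_L2_set:
  assumes "A \<in> carrier_mat m n"
  shows "frob_norm A = L2_set (\<lambda>x. A $$ x) ({..<m} \<times> {..<n})"
  using assms unfolding frob_norm_def L2_set_def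
  by (auto simp: sum.cartesian_product intro!: sum.cong)

lemma ideal_norm_frob: "ideal_norm frob_norm"
  unfolding ideal_norm_def
proof (intro conjI allI impI)
  show "frob_norm (A\<^sup>T) = frob_norm A" for A
    unfolding frob_norm_def by (subst sum.swap) (auto intro!: sum.cong)
  show "frob_norm (A + B) \<le> frob_norm A + frob_norm B"
    if A: "A \<in> carrier_mat m n" and B: "B \<in> carrier_mat m n" for m n A B
  proof -
    have "frob_norm (A + B) = L2_set (\<lambda>x. A $$ x + B $$ x) ({..<m} \<times> {..<n})"
      using A B by (subst frob_norm_L2_set[of _ m n]) (auto intro!: L2_set_cong)
    also have "\<dots> \<le> frob_norm A + frob_norm B"
      using A B by (simp add: frob_norm_L2_set L2_set_triangle_ineq)
    finally show ?thesis .
  qed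
  show "frob_norm (A * B) \<le> spectral_norm A * frob_norm B"
    if A: "A \<in> carrier_mat l m" and B: "B \<in> carrier_mat m n" for l m n A B
  proof (rule power2_le_imp_le)
    have "(frob_norm (A * B))\<^sup>2 = (\<Sum>j<n. (vec_norm2 (A *\<^sub>v col B j))\<^sup>2)"
      using A B by (simp add: frob_norm_sq_cols mult_mat_vec_def)
    also have "\<dots> \<le> (\<Sum>j<n. (spectral_norm A * vec_norm2 (col B j))\<^sup>2)"
      using B by (intro sum_mono power_mono vec_norm2_mult_le_spectral[OF A]) auto
    also have "\<dots> = (spectral_norm A * frob_norm B)\<^sup>2"
      using B by (simp add: frob_norm_sq_cols power_mult_distrib sum_distrib_left)
    finally show "(frob_norm (A * B))\<^sup>2 \<le> (spectral_norm A * frob_norm B)\<^sup>2" .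
  qed simp
qed simp

lemma ideal_normD:
  assumes "ideal_norm N"
  shows "0 \<le> N A" "N (A\<^sup>T) = N A"
    "A \<in> carrier_mat m n \<Longrightarrow> B \<in> carrier_mat m n \<Longrightarrow> N (A + B) \<le> N A + N B"
    "A \<in> carrier_mat l m \<Longrightarrow> B \<in> carrier_mat m n \<Longrightarrow> N (A * B) \<le> spectral_norm A * N B"
  using assms unfolding ideal_norm_def by blast+

lemma ideal_norm_mult_right:
  assumes N: "ideal_norm N" and A: "A \<in> carrier_mat l m" and B: "B \<in> carrier_mat m n"
  shows "N (A * B) \<le> N A * spectral_norm B"
proof -
  have "N (A * B) = N (B\<^sup>T * A\<^sup>T)"
    using ideal_normD(2)[OF N, of "A * B"] transpose_mult[OF A B] by simp
  also have "\<dots> \<le> spectral_norm (B\<^sup>T) * N (A\<^sup>T)"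
    using A B by (intro ideal_normD(4)[OF N]) auto
  finally show ?thesis
    by (simp add: ideal_normD(2)[OF N] ideal_normD(2)[OF ideal_norm_spectral] mult.commute)
qed

lemma spectral_norm_ortho_cols_le:
  assumes "V \<in> ortho_cols p r"
  shows "spectral_norm V \<le> 1" "spectral_norm (V\<^sup>T) \<le> 1"
proof -
  show "spectral_norm V \<le> 1"
    by (rule spectral_norm_leI[OF ortho_colsD(1)[OF assms]]) (simp_all add: vec_norm2_ortho_cols_mult[OF assms])
  then show "spectral_norm (V\<^sup>T) \<le> 1" by (simp add: ideal_normD(2)[OF ideal_norm_spectral])
qed

lemma vec_norm2_transpose_ortho_cols_le:
  assumes V: "V \<in> ortho_cols p r" and v: "v \<in> carrier_vec p"
  shows "vec_norm2 (V\<^sup>T *\<^sub>v v) \<le> vec_norm2 v"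
proof -
  have "vec_norm2 (V\<^sup>T *\<^sub>v v) \<le> spectral_norm (V\<^sup>T) * vec_norm2 v"
    using ortho_colsD(2)[OF V] v by (rule vec_norm2_mult_le_spectral)
  also have "\<dots> \<le> 1 * vec_norm2 v"
    using spectral_norm_ortho_cols_le[OF V] by (intro mult_right_mono) auto
  finally show ?thesis by simp
qed

section \<open>Spectral theorem for real symmetric matrices\<close>

text \<open>Over the complex numbers there is an eigenvector \<open>x + i y\<close>. Comparing \<open>x \<bullet> S y\<close> with \<open>S x \<bullet> y\<close>
  shows that its eigenvalue is real, hence the real vectors \<open>x\<close> and \<open>y\<close> satisfy the same eigenvalue
  equation, and at least one of them is nonzero.\<close>

lemma symmetric_real_eigenvector:
  fixes S :: "real mat"
  assumes S: "S \<in> carrier_mat n n" and sym: "S\<^sup>T = S" and n: "n > 0"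
  obtains v a where "v \<in> carrier_vec n" "v \<bullet> v = 1" "S *\<^sub>v v = a \<cdot>\<^sub>v v"
proof -
  let ?C = "map_mat complex_of_real S"
  have C: "?C \<in> carrier_mat n n" using S by simp
  obtain l z where "eigenvector ?C z l"
    using spectrum_non_empty[OF C n] by (auto simp: spectrum_def eigenvalue_def)
  then have z: "z \<in> carrier_vec n" "z \<noteq> 0\<^sub>v n" "?C *\<^sub>v z = l \<cdot>\<^sub>v z"
    using S by (auto simp: eigenvector_def)
  define x where "x = map_vec Re z"
  define y where "y = map_vec Im z"
  have xy: "x \<in> carrier_vec n" "y \<in> carrier_vec n" using z by (auto simp: x_def y_def)
  have comp: "(\<Sum>j<n. complex_of_real (S $$ (i, j)) * z $ j) = l * z $ i" if "i < n" for i
    using arg_cong[OF z(3), of "\<lambda>v. v $ i"] that z(1) S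
    by (simp add: scalar_prod_def atLeast0LessThan)
  have Sx: "S *\<^sub>v x = Re l \<cdot>\<^sub>v x - Im l \<cdot>\<^sub>v y"
  proof (rule eq_vecI)
    fix i assume "i < dim_vec (Re l \<cdot>\<^sub>v x - Im l \<cdot>\<^sub>v y)"
    then have i: "i < n" using xy by simp
    show "(S *\<^sub>v x) $ i = (Re l \<cdot>\<^sub>v x - Im l \<cdot>\<^sub>v y) $ i"
      using arg_cong[OF comp[OF i], of Re] i z S
      by (simp add: scalar_prod_def x_def y_def atLeast0LessThan)
  qed (use S xy in auto)
  have Sy: "S *\<^sub>v y = Im l \<cdot>\<^sub>v x + Re l \<cdot>\<^sub>v y"
  proof (rule eq_vecI)
    fix i assume "i < dim_vec (Im l \<cdot>\<^sub>v x + Re l \<cdot>\<^sub>v y)"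
    then have i: "i < n" using xy by simp
    show "(S *\<^sub>v y) $ i = (Im l \<cdot>\<^sub>v x + Re l \<cdot>\<^sub>v y) $ i"
      using arg_cong[OF comp[OF i], of Im] i z S
      by (simp add: scalar_prod_def x_def y_def atLeast0LessThan)
  qed (use S xy in auto)
  have nz: "x \<bullet> x + y \<bullet> y > 0"
  proof -
    obtain i where i: "i < n" "z $ i \<noteq> 0" using z by (metis eq_vecI carrier_vecD index_zero_vec)
    have "0 < (Re (z $ i))\<^sup>2 + (Im (z $ i))\<^sup>2"
      using i by (simp add: complex_eq_iff sum_power2_gt_zero_iff)
    also have "\<dots> \<le> (\<Sum>i<n. (Re (z $ i))\<^sup>2 + (Im (z $ i))\<^sup>2)"
      using i by (intro member_le_sum[of i]) auto
    also have "\<dots> = x \<bullet> x + y \<bullet> y"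
      using z by (simp add: scalar_prod_def x_def y_def sum.distrib power2_eq_square atLeast0LessThan)
    finally show ?thesis .
  qed
  have "x \<bullet> (S *\<^sub>v y) = (S *\<^sub>v x) \<bullet> y"
    using scalar_prod_mult_mat_vec[OF S xy] sym by simp
  \<comment> \<open>The real parts cancel, since \<open>x \<bullet> y\<close> is symmetric.\<close>
  then have "Im l * (x \<bullet> x + y \<bullet> y) = 0"
    unfolding Sx Sy using xy comm_scalar_prod[OF xy]
    by (simp add: scalar_prod_add_distrib[of _ n] minus_scalar_prod_distrib[of _ n] algebra_simps)
  then have "Im l = 0" using nz by simp
  then have ev: "S *\<^sub>v x = Re l \<cdot>\<^sub>v x" "S *\<^sub>v y = Re l \<cdot>\<^sub>v y"
    using Sx Sy xy by (auto intro!: eq_vecI)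
  have "x \<bullet> x > 0 \<or> y \<bullet> y > 0" using nz by linarith
  then obtain u where u: "u \<in> carrier_vec n" "u \<bullet> u > 0" "S *\<^sub>v u = Re l \<cdot>\<^sub>v u"
    using ev xy by blast
  define v where "v = (1 / vec_norm2 u) \<cdot>\<^sub>v u"
  have "v \<in> carrier_vec n" using u by (simp add: v_def)
  moreover have "v \<bullet> v = 1"
    using u vec_norm2_sq[of u] by (simp add: v_def power2_eq_square field_simps)
  moreover have "S *\<^sub>v v = Re l \<cdot>\<^sub>v v"
    using u S by (simp add: v_def mult_mat_vec smult_smult_assoc mult.commute)
  ultimately show ?thesis using that by blast
qed

lemma ortho_cols_iff:
  "V \<in> ortho_cols p r \<longleftrightarrow>
     V \<in> carrier_mat p r \<and> (\<forall>i<r. \<forall>j<r. col V i \<bullet> col V j = (if i = j then 1 else 0))"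
proof (cases "V \<in> carrier_mat p r")
  case True
  then show ?thesis unfolding ortho_cols_def by (auto simp: mat_eq_iff)
qed (auto simp: ortho_cols_def)

text \<open>The Householder reflection that exchanges \<open>e\<^sub>0\<close> and \<open>v\<close> is an explicit orthogonal matrix with
  first column \<open>v\<close>. It is the reflection in the hyperplane orthogonal to \<open>u = e\<^sub>0 - v\<close>, which degenerates
  for \<open>v = e\<^sub>0\<close>, where the identity serves.\<close>

lemma exists_ortho_cols_first_col:
  assumes v: "v \<in> carrier_vec n" "v \<bullet> v = 1" and n: "n > 0"
  obtains H where "H \<in> ortho_cols n n" "col H 0 = v"
proof (cases "v = unit_vec n 0")
  case True
  have "1\<^sub>m n \<in> ortho_cols n n" "col (1\<^sub>m n) 0 = v"
    using True n by (auto simp: ortho_cols_def)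
  then show ?thesis using that by blast
next
  case False
  define u where "u = unit_vec n 0 - v"
  define c where "c = 2 / (u \<bullet> u)"
  define H where "H = Matrix.mat n n (\<lambda>(i, j). (if i = j then 1 else 0) - c * u $ i * u $ j)"
  have u: "u \<in> carrier_vec n" using v by (simp add: u_def)
  have uu: "u \<bullet> u = 2 - 2 * v $ 0"
  proof -
    have "u \<bullet> u = unit_vec n 0 \<bullet> unit_vec n 0 - unit_vec n 0 \<bullet> v - (v \<bullet> unit_vec n 0 - v \<bullet> v)"
      using v unfolding u_def
      by (simp add: minus_scalar_prod_distrib[of _ n] scalar_prod_minus_distrib[of _ n])
    then show ?thesis using v n by simp
  qed
  have u0: "u \<bullet> u \<noteq> 0"
  proof
    assume "u \<bullet> u = 0"
    then have "u = 0\<^sub>v n" using conjugate_square_eq_0_vec[OF u] by simp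
    then have "v = unit_vec n 0" using v unfolding u_def
      by (metis eq_vecI carrier_vecD index_minus_vec(1) index_zero_vec(1) eq_iff_diff_eq_0 unit_vec_carrier)
    then show False using False by simp
  qed
  have H: "H \<in> carrier_mat n n" by (simp add: H_def)
  \<comment> \<open>The normalisation of a reflection \<open>1 - c u u\<^sup>T\<close> that makes it an involution.\<close>
  have cc: "c * c * (u \<bullet> u) = 2 * c" using u0 by (simp add: c_def)
  have "col H i \<bullet> col H j = (if i = j then 1 else 0)" if ij: "i < n" "j < n" for i j
  proof -
    have "col H i \<bullet> col H j = (\<Sum>k<n. ((if k = i then 1 else 0) - c * u $ k * u $ i) *
        ((if k = j then 1 else 0) - c * u $ k * u $ j))"
      using ij by (simp add: scalar_prod_def H_def atLeast0LessThan)
    also have "\<dots> = (\<Sum>k<n. (if k = i then (if k = j then 1 else 0) - c * u $ k * u $ j else 0)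
        - (if k = j then c * u $ k * u $ i else 0) + c * c * u $ i * u $ j * (u $ k * u $ k))"
      by (intro sum.cong) (auto simp: algebra_simps)
    also have "\<dots> = (if i = j then 1 else 0) - 2 * c * u $ i * u $ j + c * c * u $ i * u $ j * (u \<bullet> u)"
      using ij u by (simp add: sum.distrib sum_subtractf scalar_prod_def atLeast0LessThan flip: sum_distrib_left)
    also have "\<dots> = (if i = j then 1 else 0) + u $ i * u $ j * (c * c * (u \<bullet> u) - 2 * c)"
      by (simp add: algebra_simps)
    finally show ?thesis using cc by simp
  qed
  then have "H \<in> ortho_cols n n" using H by (simp add: ortho_cols_iff)
  moreover have "col H 0 = v"
  proof (rule eq_vecI)
    fix i assume "i < dim_vec v"
    then have i: "i < n" using v by simp
    have "u $ 0 = 1 - v $ 0" using n v by (simp add: u_def)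
    then have "c * u $ 0 = 1" using u0 uu by (simp add: c_def field_simps)
    then have "c * u $ i * u $ 0 = u $ i" by (simp add: mult.assoc mult.left_commute[of c])
    then have "col H 0 $ i = (if i = 0 then 1 else 0) - u $ i" using i n by (simp add: H_def)
    then show "col H 0 $ i = v $ i" using i v by (simp add: u_def)
  qed (use v H in auto)
  ultimately show ?thesis using that by blast
qed

lemma ortho_cols_mult:
  assumes V: "V \<in> ortho_cols p q" and W: "W \<in> ortho_cols q r"
  shows "V * W \<in> ortho_cols p r"
proof -
  note V = ortho_colsD[OF V] and W = ortho_colsD[OF W]
  have "(V * W)\<^sup>T * (V * W) = W\<^sup>T * (V\<^sup>T * (V * W))"
    using V W by (simp add: transpose_mult[OF V(1) W(1)] assoc_mult_mat[of _ r q _ p _ r])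
  also have "V\<^sup>T * (V * W) = W"
    using V W by (simp add: assoc_mult_mat[OF V(2,1) W(1), symmetric])
  finally show ?thesis using V W by (simp add: ortho_cols_def)
qed

text \<open>Deflation: in an orthonormal basis that starts with an eigenvector, a symmetric matrix has zeros
  in its first row and column off the diagonal, and the remaining block is again symmetric.\<close>

theorem real_spectral_theorem:
  fixes S :: "real mat"
  assumes "S \<in> carrier_mat n n" "S\<^sup>T = S"
  shows "\<exists>W e. W \<in> ortho_cols n n \<and> W\<^sup>T * (S * W) = mat_diag n e"
  using assms
proof (induction n arbitrary: S)
  case 0
  have "1\<^sub>m 0 \<in> ortho_cols 0 0 \<and> (1\<^sub>m 0)\<^sup>T * (S * 1\<^sub>m 0) = mat_diag 0 (\<lambda>_. 0)"
    using 0 by (auto simp: ortho_cols_def mat_diag_def intro!: eq_matI)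
  then show ?case by blast
next
  case (Suc n)
  note S = Suc.prems
  obtain v a where v: "v \<in> carrier_vec (Suc n)" "v \<bullet> v = 1" "S *\<^sub>v v = a \<cdot>\<^sub>v v"
    using symmetric_real_eigenvector[OF S] by blast
  obtain H where H: "H \<in> ortho_cols (Suc n) (Suc n)" "col H 0 = v"
    using exists_ortho_cols_first_col[OF v(1,2)] by blast
  note Hc = ortho_colsD[OF H(1)]
  define T where "T = H\<^sup>T * (S * H)"
  have SH: "S * H \<in> carrier_mat (Suc n) (Suc n)" using S Hc by auto
  have T: "T \<in> carrier_mat (Suc n) (Suc n)" using S Hc by (simp add: T_def)
  have "T\<^sup>T = (S * H)\<^sup>T * H"
    unfolding T_def by (simp add: transpose_mult[OF Hc(2) SH])
  also have "\<dots> = T"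
    using S Hc by (simp add: T_def transpose_mult[OF S(1) Hc(1)] assoc_mult_mat[of _ "Suc n" "Suc n" _ "Suc n" _ "Suc n"])
  finally have Tsym: "T\<^sup>T = T" .
  have Tsym': "T $$ (i, j) = T $$ (j, i)" if "i < Suc n" "j < Suc n" for i j
    using arg_cong[OF Tsym, of "\<lambda>M. M $$ (i, j)"] that T by simp
  have T0: "T $$ (i, 0) = (if i = 0 then a else 0)" if i: "i < Suc n" for i
  proof -
    have "T $$ (i, 0) = col H i \<bullet> (S *\<^sub>v v)"
      using i Hc S H by (simp add: T_def mult_mat_vec_def)
    also have "\<dots> = a * (col H i \<bullet> col H 0)" using v H Hc i by simp
    finally show ?thesis using H(1) i by (auto simp: ortho_cols_iff)
  qed
  define T' where "T' = Matrix.mat n n (\<lambda>(i, j). T $$ (Suc i, Suc j))"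
  define D where "D = Matrix.mat 1 1 (\<lambda>_. a)"
  have T': "T' \<in> carrier_mat n n" "T'\<^sup>T = T'" using Tsym' by (auto simp: T'_def)
  have D: "D \<in> carrier_mat 1 1" by (simp add: D_def)
  have Tb: "T = four_block_mat D (0\<^sub>m 1 n) (0\<^sub>m n 1) T'"
  proof (rule eq_matI)
    fix i j assume "i < dim_row (four_block_mat D (0\<^sub>m 1 n) (0\<^sub>m n 1) T')"
      "j < dim_col (four_block_mat D (0\<^sub>m 1 n) (0\<^sub>m n 1) T')"
    then have "i < Suc n" "j < Suc n" by (auto simp: T'_def D_def)
    then show "T $$ (i, j) = four_block_mat D (0\<^sub>m 1 n) (0\<^sub>m n 1) T' $$ (i, j)"
      using T0[of i] T0[of j] Tsym'[of 0 j]
      by (cases i; cases j) (auto simp: T'_def D_def)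
  qed (use T in \<open>auto simp: T'_def D_def\<close>)
  obtain W' e where W': "W' \<in> ortho_cols n n" "W'\<^sup>T * (T' * W') = mat_diag n e"
    using Suc.IH[OF T'] by blast
  note W'c = ortho_colsD[OF W'(1)]
  define W where "W = four_block_mat (1\<^sub>m 1) (0\<^sub>m 1 n) (0\<^sub>m n 1) W'"
  have Wt: "W\<^sup>T = four_block_mat (1\<^sub>m 1) (0\<^sub>m 1 n) (0\<^sub>m n 1) W'\<^sup>T"
    unfolding W_def using W'c by (subst transpose_four_block_mat[of _ 1 1 _ n _ n]) auto
  have "W\<^sup>T * W = 1\<^sub>m (1 + n)"
    unfolding Wt unfolding W_def
    using W'c by (subst mult_four_block_mat[of _ 1 1 _ n _ n _ _ 1 _ n]) auto
  moreover have W: "W \<in> carrier_mat (Suc n) (Suc n)"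
    using four_block_carrier_mat[of "1\<^sub>m 1" 1 1 W' n n] W'c by (simp add: W_def)
  ultimately have Wo: "W \<in> ortho_cols (Suc n) (Suc n)" by (simp add: ortho_cols_def)
  have "T * W = four_block_mat D (0\<^sub>m 1 n) (0\<^sub>m n 1) (T' * W')"
    unfolding Tb W_def using W'c T' D
    by (subst mult_four_block_mat[of _ 1 1 _ n _ n _ _ 1 _ n]) auto
  then have "W\<^sup>T * (T * W) = four_block_mat D (0\<^sub>m 1 n) (0\<^sub>m n 1) (mat_diag n e)"
    unfolding Wt using W'c T' D W'(2)
    by (simp, subst mult_four_block_mat[of _ 1 1 _ n _ n _ _ 1 _ n]) auto
  also have "\<dots> = mat_diag (Suc n) (case_nat a e)"
    by (rule eq_matI) (auto simp: D_def mat_diag_def split: nat.split)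
  finally have diag: "W\<^sup>T * (T * W) = mat_diag (Suc n) (case_nat a e)" .
  have "(H * W)\<^sup>T * (S * (H * W)) = W\<^sup>T * (T * W)"
    using S Hc W unfolding T_def
    by (simp add: transpose_mult[OF Hc(1) W] assoc_mult_mat[of _ "Suc n" "Suc n" _ "Suc n" _ "Suc n"])
  then show ?case using diag ortho_cols_mult[OF H(1) Wo] by metis
qed

lemma char_poly_mat_diag: "char_poly (mat_diag n e) = (\<Prod>i\<leftarrow>[0..<n]. [:- e i, 1:])"
proof -
  have "upper_triangular (mat_diag n e)" by (auto simp: mat_diag_def)
  then have "char_poly (mat_diag n e) = (\<Prod>a\<leftarrow>diag_mat (mat_diag n e). [:- a, 1:])"
    by (rule char_poly_upper_triangular[OF mat_diag_dim])
  moreover have "diag_mat (mat_diag n e) = map e [0..<n]"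
    by (auto simp: diag_mat_def mat_diag_def)
  ultimately show ?thesis by (simp add: o_def)
qed

lemma proots_linear_factors: "proots (\<Prod>a\<leftarrow>as. [:- a, 1:] :: 'a :: idom poly) = mset as"
proof (induction as)
  case (Cons a as)
  have "(\<Prod>a\<leftarrow>as. [:- a, 1:]) \<noteq> (0 :: 'a poly)" by (auto simp: prod_list_zero_iff)
  then show ?case using Cons by (simp add: proots_mult del: mult_pCons_left)
qed simp

lemma ortho_cols_square:
  assumes "W \<in> ortho_cols n n"
  shows "W * W\<^sup>T = 1\<^sub>m n"
  using ortho_colsD[OF assms] mat_mult_left_right_inverse by blast

text \<open>This links the algebraic definition of singular values, by roots of a characteristic polynomial
  counted with multiplicity, to an orthonormal eigenbasis. In particular no root is lost over the reals.\<close>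

lemma proots_char_poly_diagonalized:
  assumes S: "S \<in> carrier_mat n n" and W: "W \<in> ortho_cols n n"
    and diag: "W\<^sup>T * (S * W) = mat_diag n e"
  shows "proots (char_poly S) = mset (map e [0..<n])"
proof -
  note Wc = ortho_colsD[OF W]
  have "W * mat_diag n e * W\<^sup>T = (W * W\<^sup>T) * S * (W * W\<^sup>T)"
    unfolding diag[symmetric] using S Wc
    by (simp add: assoc_mult_mat[of _ n n _ n _ n])
  then have "S = W * mat_diag n e * W\<^sup>T" using S by (simp add: ortho_cols_square[OF W])
  then have "similar_mat S (mat_diag n e)"
    unfolding similar_mat_def similar_mat_wit_def Let_def
    using S Wc ortho_cols_square[OF W] by (intro exI[of _ W] exI[of _ "W\<^sup>T"]) auto
  then have "char_poly S = (\<Prod>a\<leftarrow>map e [0..<n]. [:- a, 1:])"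
    by (simp add: char_poly_similar char_poly_mat_diag o_def)
  then show ?thesis by (simp only: proots_linear_factors)
qed

section \<open>Singular values\<close>

lemma mat_diag_mult_vec:
  fixes f :: "nat \<Rightarrow> real"
  assumes c: "c \<in> carrier_vec n"
  shows "mat_diag n f *\<^sub>v c = Matrix.vec n (\<lambda>i. f i * c $ i)"
proof (rule eq_vecI)
  fix i assume "i < dim_vec (Matrix.vec n (\<lambda>i. f i * c $ i))"
  then have i: "i < n" by simp
  have "(mat_diag n f *\<^sub>v c) $ i = (\<Sum>j<n. if j = i then f i * c $ i else 0)"
  proof -
    have "(mat_diag n f *\<^sub>v c) $ i = (\<Sum>j<n. (if i = j then f j else 0) * c $ j)"
      using i c by (simp add: mat_diag_def scalar_prod_def atLeast0LessThan)
    also have "\<dots> = (\<Sum>j<n. if j = i then f i * c $ i else 0)" by (intro sum.cong) auto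
    finally show ?thesis .
  qed
  then show "(mat_diag n f *\<^sub>v c) $ i = Matrix.vec n (\<lambda>i. f i * c $ i) $ i" using i by simp
qed (simp add: mat_diag_def)

text \<open>The columns of \<open>W\<close> are right singular vectors with singular values \<open>d 0 \<ge> d 1 \<ge> \<dots>\<close>. There are
  \<open>dim_col A\<close> of them, so that \<open>W\<close> is a full orthonormal basis; those beyond the number of rows are not
  entries of \<^const>\<open>sing_vals\<close>. The last clause is what makes the basis useful: \<open>|A x|\<^sup>2\<close> is diagonal in
  the coordinates of \<open>x\<close>.\<close>

definition right_singular_system :: "real mat \<Rightarrow> real mat \<Rightarrow> (nat \<Rightarrow> real) \<Rightarrow> bool" where
  "right_singular_system A W d \<longleftrightarrow> (let m = dim_row A; n = dim_col A in
     W \<in> ortho_cols n n \<and> (\<forall>i<n. 0 \<le> d i) \<and> (\<forall>j<n. \<forall>i\<le>j. d j \<le> d i) \<and>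
     (\<forall>i<min m n. sing_val A (Suc i) = d i) \<and>
     (\<forall>c\<in>carrier_vec n. (vec_norm2 (A *\<^sub>v (W *\<^sub>v c)))\<^sup>2 = (\<Sum>i<n. (d i)\<^sup>2 * (c $ i)\<^sup>2)))"

lemma right_singular_systemD:
  assumes "right_singular_system A W d" "A \<in> carrier_mat m n"
  shows "W \<in> ortho_cols n n" "i < n \<Longrightarrow> 0 \<le> d i" "i \<le> j \<Longrightarrow> j < n \<Longrightarrow> d j \<le> d i"
    "i < min m n \<Longrightarrow> sing_val A (Suc i) = d i"
    "c \<in> carrier_vec n \<Longrightarrow> (vec_norm2 (A *\<^sub>v (W *\<^sub>v c)))\<^sup>2 = (\<Sum>i<n. (d i)\<^sup>2 * (c $ i)\<^sup>2)"
  using assms(1) unfolding right_singular_system_def Let_def carrier_matD[OF assms(2)]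
  by simp_all

text \<open>An orthonormal eigenbasis of \<open>A\<^sup>T A\<close>, with its columns permuted so that the eigenvalues decrease.\<close>

lemma right_singular_system_exists:
  assumes A: "A \<in> carrier_mat m n"
  obtains W d where "right_singular_system A W d"
proof -
  define S where "S = A\<^sup>T * A"
  have S: "S \<in> carrier_mat n n" "S\<^sup>T = S"
    using A transpose_mult[of "A\<^sup>T" n m A n] by (auto simp: S_def)
  obtain W0 e where W0: "W0 \<in> ortho_cols n n" and e: "W0\<^sup>T * (S * W0) = mat_diag n e"
    using real_spectral_theorem[OF S] by blast
  note W0c = ortho_colsD[OF W0]
  have AW0: "A * W0 \<in> carrier_mat m n" using A W0c by simp
  have "W0\<^sup>T * (S * W0) = (A * W0)\<^sup>T * (A * W0)"
    using A W0c AW0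
    by (simp add: S_def transpose_mult[OF A W0c(1)] assoc_mult_mat[of _ n m _ n _ n] assoc_mult_mat[of _ n n _ m _ n])
  then have gram: "col (A * W0) i \<bullet> col (A * W0) j = (if i = j then e i else 0)" if "i < n" "j < n" for i j
    using that A W0c AW0 arg_cong[OF e, of "\<lambda>M. M $$ (i, j)"] by (simp add: mat_diag_def)
  have e0: "0 \<le> e i" if "i < n" for i
    using gram[OF that that] vec_norm2_sq[of "col (A * W0) i"] by (metis zero_le_power2)
  define xs where "xs = map (\<lambda>i. sqrt (e i)) [0..<n]"
  define L where "L = rev (sort xs)"
  have "mset L = mset xs" by (simp add: L_def)
  then obtain p where p: "p permutes {..<length xs}" "permute_list p xs = L"
    by (rule mset_eq_permutation)
  have pn: "p permutes {..<n}" using p by (simp add: xs_def)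
  have p_less: "p i < n" if "i < n" for i using permutes_in_image[OF pn, of i] that by simp
  have L_nth: "L ! i = sqrt (e (p i))" if "i < n" for i
    using permute_list_nth[OF p(1), of i] p_less[OF that] that p(2) by (simp add: xs_def)
  have len: "length L = n" by (simp add: L_def xs_def)
  have "sing_vals A = take (min m n) L"
    using A proots_char_poly_diagonalized[OF S(1) W0 e]
    by (simp add: sing_vals_def S_def L_def xs_def o_def flip: mset_map)
  then have sv: "sing_val A (Suc i) = L ! i" if "i < min m n" for i
    using that by (simp add: sing_val_def)
  define W where "W = Matrix.mat n n (\<lambda>(i, j). W0 $$ (i, p j))"
  have W: "W \<in> carrier_mat n n" by (simp add: W_def)
  have colW: "col W j = col W0 (p j)" if "j < n" for j
    using that p_less[OF that] W0c by (intro eq_vecI) (auto simp: W_def)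
  have p_eq: "p i = p j \<longleftrightarrow> i = j" for i j using permutes_inj[OF pn] by (metis injD)
  have Wo: "W \<in> ortho_cols n n"
    using W0 W by (auto simp: ortho_cols_iff colW p_less p_eq)
  have AW: "A * W \<in> carrier_mat m n" using A W by simp
  have AtW: "(A * W)\<^sup>T * (A * W) = mat_diag n (\<lambda>i. (L ! i)\<^sup>2)"
  proof (rule eq_matI)
    fix i j assume "i < dim_row (mat_diag n (\<lambda>i. (L ! i)\<^sup>2))" "j < dim_col (mat_diag n (\<lambda>i. (L ! i)\<^sup>2))"
    then have ij: "i < n" "j < n" by (auto simp: mat_diag_def)
    have "((A * W)\<^sup>T * (A * W)) $$ (i, j) = col (A * W0) (p i) \<bullet> col (A * W0) (p j)"
      using ij AW A W W0c p_less
      by (simp add: colW col_mult2[OF A W] col_mult2[OF A W0c(1)] del: col_mult2)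
    then show "((A * W)\<^sup>T * (A * W)) $$ (i, j) = mat_diag n (\<lambda>i. (L ! i)\<^sup>2) $$ (i, j)"
      using ij gram[of "p i" "p j"] p_less L_nth e0 by (simp add: p_eq mat_diag_def)
  qed (use AW W in \<open>auto simp: mat_diag_def\<close>)
  have norm: "(vec_norm2 (A *\<^sub>v (W *\<^sub>v c)))\<^sup>2 = (\<Sum>i<n. (L ! i)\<^sup>2 * (c $ i)\<^sup>2)" if c: "c \<in> carrier_vec n" for c
  proof -
    have "A *\<^sub>v (W *\<^sub>v c) = (A * W) *\<^sub>v c" using assoc_mult_mat_vec[OF A W c] by simp
    then have "(vec_norm2 (A *\<^sub>v (W *\<^sub>v c)))\<^sup>2 = ((A * W) *\<^sub>v c) \<bullet> ((A * W) *\<^sub>v c)"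
      by (simp only: vec_norm2_sq)
    also have "\<dots> = c \<bullet> ((A * W)\<^sup>T *\<^sub>v ((A * W) *\<^sub>v c))"
      by (rule scalar_prod_mult_mat_vec[OF AW c mult_mat_vec_carrier[OF AW c]])
    also have "(A * W)\<^sup>T *\<^sub>v ((A * W) *\<^sub>v c) = mat_diag n (\<lambda>i. (L ! i)\<^sup>2) *\<^sub>v c"
      using AtW assoc_mult_mat_vec[of "(A * W)\<^sup>T" n m "A * W" n c] AW c by simp
    also have "c \<bullet> \<dots> = (\<Sum>i<n. (L ! i)\<^sup>2 * (c $ i)\<^sup>2)"
      using c by (auto simp: mat_diag_mult_vec scalar_prod_def atLeast0LessThan power2_eq_square intro!: sum.cong)
    finally show ?thesis .
  qed
  have mono: "L ! j \<le> L ! i" if "i \<le> j" "j < n" for i j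
    by (rule sorted_rev_nth_mono) (use that len in \<open>auto simp: L_def\<close>)
  have nonneg: "0 \<le> L ! i" if "i < n" for i using L_nth[OF that] e0 p_less[OF that] by simp
  have "right_singular_system A W ((!) L)"
    unfolding right_singular_system_def Let_def carrier_matD[OF A]
    by (intro conjI allI impI ballI Wo nonneg mono sv norm)
  then show ?thesis using that by blast
qed

lemma sing_val_nonneg:
  assumes A: "A \<in> carrier_mat m n" and i: "1 \<le> i" "i \<le> min m n"
  shows "0 \<le> sing_val A i"
proof -
  obtain W d where sys: "right_singular_system A W d"
    using right_singular_system_exists[OF A] by blast
  note W = right_singular_systemD(1)[OF sys A] and d = right_singular_systemD(2,3,4)[OF sys A]
    and eq = right_singular_systemD(5)[OF sys A]
  have "i - 1 < n" "i - 1 < min m n" "Suc (i - 1) = i" using i by auto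
  then show ?thesis using d(1)[of "i - 1"] d(3)[of "i - 1"] by simp
qed

lemma sing_val_antimono:
  assumes A: "A \<in> carrier_mat m n" and i: "1 \<le> i" "i \<le> j" "j \<le> min m n"
  shows "sing_val A j \<le> sing_val A i"
proof -
  obtain W d where sys: "right_singular_system A W d"
    using right_singular_system_exists[OF A] by blast
  have sv: "sing_val A k = d (k - 1)" if "1 \<le> k" "k \<le> min m n" for k
  proof -
    have "k - 1 < min m n" "Suc (k - 1) = k" using that by auto
    then show ?thesis using right_singular_systemD(4)[OF sys A, of "k - 1"] by simp
  qed
  have "sing_val A i = d (i - 1)" "sing_val A j = d (j - 1)"
    using sv[of i] sv[of j] i by auto
  moreover have "d (j - 1) \<le> d (i - 1)"
    by (rule right_singular_systemD(3)[OF sys A]) (use i in auto)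
  ultimately show ?thesis by simp
qed

lemma vec_norm2_sq_sum: "v \<in> carrier_vec n \<Longrightarrow> (vec_norm2 v)\<^sup>2 = (\<Sum>i<n. (v $ i)\<^sup>2)"
  unfolding vec_norm2_sq by (simp add: scalar_prod_def atLeast0LessThan power2_eq_square)

lemma ortho_cols_square_mult_transpose_vec:
  assumes W: "W \<in> ortho_cols n n" and v: "v \<in> carrier_vec n"
  shows "W *\<^sub>v (W\<^sup>T *\<^sub>v v) = v"
  using assoc_mult_mat_vec[OF ortho_colsD(1,2)[OF W] v] ortho_cols_square[OF W] v by simp

lemma sing_val_last_mult_le:
  assumes M: "M \<in> carrier_mat r r" and w: "w \<in> carrier_vec r" and r: "1 \<le> r"
  shows "sing_val M r * vec_norm2 w \<le> vec_norm2 (M *\<^sub>v w)"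
proof (rule power2_le_imp_le)
  obtain W d where sys: "right_singular_system M W d"
    using right_singular_system_exists[OF M] by blast
  note W = right_singular_systemD(1)[OF sys M] and d = right_singular_systemD(2,3,4)[OF sys M]
    and eq = right_singular_systemD(5)[OF sys M]
  define c where "c = W\<^sup>T *\<^sub>v w"
  have c: "c \<in> carrier_vec r" using ortho_colsD(2)[OF W] w by (simp add: c_def)
  have Wc: "W *\<^sub>v c = w" unfolding c_def by (rule ortho_cols_square_mult_transpose_vec[OF W w])
  have sv: "sing_val M r = d (r - 1)" using d(3)[of "r - 1"] r by simp
  have "(sing_val M r * vec_norm2 w)\<^sup>2 = (\<Sum>i<r. (d (r - 1))\<^sup>2 * (c $ i)\<^sup>2)"
    using vec_norm2_ortho_cols_mult[OF W c] vec_norm2_sq_sum[OF c]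
    by (simp add: Wc sv power_mult_distrib sum_distrib_left)
  also have "\<dots> \<le> (\<Sum>i<r. (d i)\<^sup>2 * (c $ i)\<^sup>2)"
    using d r by (intro sum_mono mult_right_mono power_mono) auto
  also have "\<dots> = (vec_norm2 (M *\<^sub>v w))\<^sup>2" using eq[OF c] Wc by simp
  finally show "(sing_val M r * vec_norm2 w)\<^sup>2 \<le> (vec_norm2 (M *\<^sub>v w))\<^sup>2" .
qed simp

text \<open>The \<open>r - 1\<close> equations in \<open>r\<close> unknowns, completed by a zero row, form a singular square matrix.\<close>

lemma exists_nonzero_orthogonal_combination:
  fixes G :: "real mat"
  assumes G: "G \<in> carrier_mat n r" and r: "1 \<le> r" "r \<le> n"
  obtains w where "w \<in> carrier_vec r" "w \<noteq> 0\<^sub>v r" "\<And>i. i < r - 1 \<Longrightarrow> (G *\<^sub>v w) $ i = 0"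
proof -
  define K where "K = Matrix.mat r r (\<lambda>(i, j). if i < r - 1 then G $$ (i, j) else 0)"
  have K: "K \<in> carrier_mat r r" by (simp add: K_def)
  have "K\<^sup>T *\<^sub>v unit_vec r (r - 1) = 0\<^sub>v r"
    using r by (intro eq_vecI) (auto simp: K_def)
  moreover have "unit_vec r (r - 1) \<noteq> (0\<^sub>v r :: real vec)"
    using r by (auto simp: vec_eq_iff intro!: exI[of _ "r - 1"])
  moreover have "unit_vec r (r - 1) \<in> (carrier_vec r :: real vec set)" by simp
  ultimately have ex: "\<exists>v. v \<in> carrier_vec r \<and> v \<noteq> 0\<^sub>v r \<and> K\<^sup>T *\<^sub>v v = 0\<^sub>v r" by blast
  have "K\<^sup>T \<in> carrier_mat r r" using K by simp
  from iffD2[OF det_0_iff_vec_prod_zero[OF this] ex] have "det K\<^sup>T = 0" .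
  then have "det K = 0" using det_transpose[OF K] by simp
  then obtain w where w: "w \<in> carrier_vec r" "w \<noteq> 0\<^sub>v r" "K *\<^sub>v w = 0\<^sub>v r"
    using iffD1[OF det_0_iff_vec_prod_zero[OF K]] by blast
  have "(G *\<^sub>v w) $ i = 0" if i: "i < r - 1" for i
  proof -
    have "row G i = row K i" using i r G by (intro eq_vecI) (auto simp: K_def)
    then have "(G *\<^sub>v w) $ i = (K *\<^sub>v w) $ i" using i r G K by simp
    then show ?thesis using w i by simp
  qed
  then show ?thesis using that w by blast
qed

text \<open>A dimension count as in the Courant--Fischer theorem. The \<open>r\<close>-dimensional column space of \<open>V\<close>
  contains a nonzero vector \<open>V w\<close> orthogonal to the first \<open>r - 1\<close> right singular vectors of \<open>A\<close>. On it
  \<open>A\<close> expands by at most \<open>\<sigma>\<^sub>r(A)\<close>, whereas the \<open>r \<times> r\<close> matrix \<open>U\<^sup>T A V\<close> expands every vector by at least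
  its smallest singular value, and multiplication by \<open>U\<^sup>T\<close> does not increase norms.\<close>

lemma sing_val_compression_le:
  assumes A: "A \<in> carrier_mat m n" and U: "U \<in> ortho_cols m r" and V: "V \<in> ortho_cols n r"
    and r: "1 \<le> r" "r \<le> min m n"
  shows "sing_val (U\<^sup>T * A * V) r \<le> sing_val A r"
proof -
  note Uc = ortho_colsD[OF U] and Vc = ortho_colsD[OF V]
  define B where "B = U\<^sup>T * A * V"
  have B: "B \<in> carrier_mat r r" using A Uc Vc by (simp add: B_def)
  obtain W d where sys: "right_singular_system A W d"
    using right_singular_system_exists[OF A] by blast
  note W = right_singular_systemD(1)[OF sys A] and d = right_singular_systemD(2,3,4)[OF sys A]
    and eq = right_singular_systemD(5)[OF sys A]
  note Wc = ortho_colsD[OF W]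
  have WV: "W\<^sup>T * V \<in> carrier_mat n r" using Wc Vc by simp
  obtain w where w: "w \<in> carrier_vec r" "w \<noteq> 0\<^sub>v r" "\<And>i. i < r - 1 \<Longrightarrow> (W\<^sup>T * V *\<^sub>v w) $ i = 0"
    using exists_nonzero_orthogonal_combination[OF WV r(1)] r(2) by auto
  define c where "c = W\<^sup>T *\<^sub>v (V *\<^sub>v w)"
  have Vw: "V *\<^sub>v w \<in> carrier_vec n" using Vc w by simp
  have c: "c \<in> carrier_vec n" using Wc(2) Vw unfolding c_def by (rule mult_mat_vec_carrier)
  have c0: "c $ i = 0" if "i < r - 1" for i
    using w(3)[OF that] assoc_mult_mat_vec[OF Wc(2) Vc(1) w(1)] by (simp add: c_def)
  have Wcv: "W *\<^sub>v c = V *\<^sub>v w" unfolding c_def by (rule ortho_cols_square_mult_transpose_vec[OF W Vw])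
  have "r - 1 < min m n" "Suc (r - 1) = r" using r by auto
  then have sv: "sing_val A r = d (r - 1)" using d(3)[of "r - 1"] by simp
  have nc: "vec_norm2 c = vec_norm2 w"
    using vec_norm2_ortho_cols_mult[OF W c] vec_norm2_ortho_cols_mult[OF V w(1)] Wcv by simp
  have "(vec_norm2 (A *\<^sub>v (V *\<^sub>v w)))\<^sup>2 = (\<Sum>i<n. (d i)\<^sup>2 * (c $ i)\<^sup>2)"
    using eq[OF c] Wcv by simp
  also have "\<dots> \<le> (\<Sum>i<n. (d (r - 1))\<^sup>2 * (c $ i)\<^sup>2)"
  proof (rule sum_mono)
    fix i assume "i \<in> {..<n}"
    then show "(d i)\<^sup>2 * (c $ i)\<^sup>2 \<le> (d (r - 1))\<^sup>2 * (c $ i)\<^sup>2"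
      using d c0[of i] by (cases "i < r - 1") (auto intro!: mult_right_mono power_mono)
  qed
  also have "\<dots> = (sing_val A r * vec_norm2 w)\<^sup>2"
    by (simp add: sv power_mult_distrib sum_distrib_left vec_norm2_sq_sum[OF c] flip: nc)
  finally have "vec_norm2 (A *\<^sub>v (V *\<^sub>v w)) \<le> sing_val A r * vec_norm2 w"
    by (rule power2_le_imp_le) (use sing_val_nonneg[OF A r] in auto)
  moreover have "vec_norm2 (B *\<^sub>v w) \<le> vec_norm2 (A *\<^sub>v (V *\<^sub>v w))"
  proof -
    have UA: "U\<^sup>T * A \<in> carrier_mat r n" using Uc A by simp
    have "B *\<^sub>v w = U\<^sup>T *\<^sub>v (A *\<^sub>v (V *\<^sub>v w))"
      unfolding B_def assoc_mult_mat_vec[OF UA Vc(1) w(1)] assoc_mult_mat_vec[OF Uc(2) A Vw] ..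
    then show ?thesis
      using vec_norm2_transpose_ortho_cols_le[OF U mult_mat_vec_carrier[OF A Vw]] by simp
  qed
  moreover have "sing_val B r * vec_norm2 w \<le> vec_norm2 (B *\<^sub>v w)"
    by (rule sing_val_last_mult_le[OF B w(1) r(1)])
  ultimately have "sing_val B r * vec_norm2 w \<le> sing_val A r * vec_norm2 w" by linarith
  moreover have "0 < vec_norm2 w"
    using w(2) conjugate_square_eq_0_vec[OF w(1)] vec_norm2_sq[of w]
    by (cases "vec_norm2 w = 0") (auto simp: less_le)
  ultimately show ?thesis by (simp add: B_def)
qed

section \<open>The sines of the principal angles\<close>

lemma spectral_norm_mat_diag_le:
  assumes "\<And>i. i < n \<Longrightarrow> \<bar>f i\<bar> \<le> c" "0 \<le> c"
  shows "spectral_norm (mat_diag n f) \<le> c"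
proof (rule spectral_norm_leI[OF mat_diag_dim assms(2)])
  fix v :: "real vec" assume v: "v \<in> carrier_vec n"
  have "(vec_norm2 (mat_diag n f *\<^sub>v v))\<^sup>2 = (\<Sum>i<n. (f i)\<^sup>2 * (v $ i)\<^sup>2)"
    using v by (simp add: mat_diag_mult_vec vec_norm2_sq_sum[of _ n] power_mult_distrib)
  also have "\<dots> \<le> (\<Sum>i<n. c\<^sup>2 * (v $ i)\<^sup>2)"
    using assms by (intro sum_mono mult_right_mono) (auto simp: abs_le_square_iff[symmetric])
  also have "\<dots> = (c * vec_norm2 v)\<^sup>2"
    by (simp add: power_mult_distrib vec_norm2_sq_sum[OF v] sum_distrib_left)
  finally show "vec_norm2 (mat_diag n f *\<^sub>v v) \<le> c * vec_norm2 v"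
    by (rule power2_le_imp_le) (use assms(2) in auto)
qed

lemma frob_norm_mat_diag_sq: "(frob_norm (mat_diag n f))\<^sup>2 = (\<Sum>i<n. (f i)\<^sup>2)"
proof -
  have "(\<Sum>j<n. (mat_diag n f $$ (i, j))\<^sup>2) = (f i)\<^sup>2" if "i < n" for i
  proof -
    have "(\<Sum>j<n. (mat_diag n f $$ (i, j))\<^sup>2) = (\<Sum>j<n. if j = i then (f i)\<^sup>2 else 0)"
      using that by (intro sum.cong) (auto simp: mat_diag_def)
    then show ?thesis using that by simp
  qed
  then show ?thesis by (simp add: frob_norm_sq carrier_matD[OF mat_diag_dim])
qed

lemma vec_norm2_split_complement:
  assumes V: "V \<in> ortho_cols p r" and Vp: "Vp \<in> ortho_cols p k"
    and compl: "V * V\<^sup>T + Vp * Vp\<^sup>T = 1\<^sub>m p" and x: "x \<in> carrier_vec p"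
  shows "(vec_norm2 (V\<^sup>T *\<^sub>v x))\<^sup>2 + (vec_norm2 (Vp\<^sup>T *\<^sub>v x))\<^sup>2 = (vec_norm2 x)\<^sup>2"
proof -
  note Vc = ortho_colsD[OF V] and Vpc = ortho_colsD[OF Vp]
  have sq: "(vec_norm2 (M\<^sup>T *\<^sub>v x))\<^sup>2 = x \<bullet> ((M * M\<^sup>T) *\<^sub>v x)" if M: "M \<in> carrier_mat p q" for M :: "real mat" and q
  proof -
    have Mt: "M\<^sup>T \<in> carrier_mat q p" using M by simp
    show ?thesis
      unfolding vec_norm2_sq scalar_prod_mult_mat_vec[OF Mt x mult_mat_vec_carrier[OF Mt x]]
      using assoc_mult_mat_vec[OF M Mt x] by simp
  qed
  have c1: "V * V\<^sup>T \<in> carrier_mat p p" "Vp * Vp\<^sup>T \<in> carrier_mat p p" using Vc Vpc by auto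
  have "x = (V * V\<^sup>T) *\<^sub>v x + (Vp * Vp\<^sup>T) *\<^sub>v x"
    using add_mult_distrib_mat_vec[OF c1 x] compl x by simp
  then have "x \<bullet> x = x \<bullet> ((V * V\<^sup>T) *\<^sub>v x) + x \<bullet> ((Vp * Vp\<^sup>T) *\<^sub>v x)"
    using scalar_prod_add_distrib[OF x mult_mat_vec_carrier[OF c1(1) x] mult_mat_vec_carrier[OF c1(2) x]] by simp
  then show ?thesis using sq[OF Vc(1)] sq[OF Vpc(1)] by (simp add: vec_norm2_sq)
qed

text \<open>If \<open>w\<close> is a unit right singular vector of \<open>V\<^sup>T Y\<close> for the singular value \<open>cos \<theta>\<close>, then
  \<open>1 = |Y w|\<^sup>2 = |V\<^sup>T Y w|\<^sup>2 + |Vp\<^sup>T Y w|\<^sup>2\<close>, so that \<open>|Vp\<^sup>T Y w| = sin \<theta>\<close>. Thus the sines of the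
  principal angles are column norms of \<open>Vp\<^sup>T Y W\<close> for an orthogonal \<open>W\<close>, and they are bounded through
  norms of \<open>Vp\<^sup>T Y\<close>.\<close>

lemma sin_Theta_eq_norms:
  assumes V: "V \<in> ortho_cols p r" and Vp: "Vp \<in> ortho_cols p k"
    and compl: "V * V\<^sup>T + Vp * Vp\<^sup>T = 1\<^sub>m p" and Y: "Y \<in> ortho_cols p r"
  obtains W where "W \<in> ortho_cols r r"
    "sin_Theta V Y = mat_diag r (\<lambda>i. vec_norm2 ((Vp\<^sup>T * Y) *\<^sub>v col W i))"
proof -
  note Vc = ortho_colsD[OF V] and Vpc = ortho_colsD[OF Vp] and Yc = ortho_colsD[OF Y]
  have P: "V\<^sup>T * Y \<in> carrier_mat r r" using Vc Yc by simp
  obtain W d where sys: "right_singular_system (V\<^sup>T * Y) W d"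
    using right_singular_system_exists[OF P] by blast
  note W = right_singular_systemD(1)[OF sys P] and d = right_singular_systemD(2,3,4)[OF sys P]
    and eq = right_singular_systemD(5)[OF sys P]
  have "sin (arccos (sing_val (V\<^sup>T * Y) (i + 1))) = vec_norm2 ((Vp\<^sup>T * Y) *\<^sub>v col W i)" if i: "i < r" for i
  proof -
    define w where "w = col W i"
    have w: "w \<in> carrier_vec r" using ortho_colsD(1)[OF W] i by (simp add: w_def)
    have nw: "vec_norm2 w = 1" using W i by (simp add: w_def ortho_cols_iff vec_norm2_def)
    have "W *\<^sub>v unit_vec r i = w"
      unfolding w_def using ortho_colsD(1)[OF W] i by (intro eq_vecI) auto
    then have "(vec_norm2 (V\<^sup>T * Y *\<^sub>v w))\<^sup>2 = (\<Sum>j<r. (d j)\<^sup>2 * (unit_vec r i $ j)\<^sup>2)"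
      using eq[of "unit_vec r i"] by simp
    also have "\<dots> = (\<Sum>j<r. if j = i then (d i)\<^sup>2 else 0)"
      using i by (intro sum.cong) auto
    finally have Pw: "(vec_norm2 (V\<^sup>T * Y *\<^sub>v w))\<^sup>2 = (d i)\<^sup>2" using i by simp
    have Yw: "Y *\<^sub>v w \<in> carrier_vec p" using Yc(1) w by (rule mult_mat_vec_carrier)
    have "(vec_norm2 (V\<^sup>T * Y *\<^sub>v w))\<^sup>2 + (vec_norm2 (Vp\<^sup>T * Y *\<^sub>v w))\<^sup>2 = 1"
      using vec_norm2_split_complement[OF V Vp compl Yw] vec_norm2_ortho_cols_mult[OF Y w] nw
        assoc_mult_mat_vec[OF Vc(2) Yc(1) w] assoc_mult_mat_vec[OF Vpc(2) Yc(1) w] by simp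
    then have Qw: "(vec_norm2 (Vp\<^sup>T * Y *\<^sub>v w))\<^sup>2 = 1 - (d i)\<^sup>2" using Pw by simp
    then have "(d i)\<^sup>2 \<le> 1" by (metis diff_ge_0_iff_ge zero_le_power2)
    then have "d i \<le> 1" using d(1)[OF i] by (simp add: abs_square_le_1)
    then have "sin (arccos (d i)) = sqrt (1 - (d i)\<^sup>2)" using d(1)[OF i] by (simp add: sin_arccos)
    also have "\<dots> = vec_norm2 (Vp\<^sup>T * Y *\<^sub>v w)" by (simp flip: Qw)
    finally show ?thesis using d(3)[of i] i by (simp add: w_def)
  qed
  then have "sin_Theta V Y = mat_diag r (\<lambda>i. vec_norm2 ((Vp\<^sup>T * Y) *\<^sub>v col W i))"
    using Vc unfolding sin_Theta_def by (auto simp: mat_diag_def)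
  then show ?thesis using that W by blast
qed

lemma spectral_norm_sin_Theta_le:
  assumes V: "V \<in> ortho_cols p r" and Vp: "Vp \<in> ortho_cols p k"
    and compl: "V * V\<^sup>T + Vp * Vp\<^sup>T = 1\<^sub>m p" and Y: "Y \<in> ortho_cols p r"
  shows "spectral_norm (sin_Theta V Y) \<le> spectral_norm (Vp\<^sup>T * Y)"
proof -
  obtain W where W: "W \<in> ortho_cols r r"
    and s: "sin_Theta V Y = mat_diag r (\<lambda>i. vec_norm2 ((Vp\<^sup>T * Y) *\<^sub>v col W i))"
    using sin_Theta_eq_norms[OF assms] by blast
  have Q: "Vp\<^sup>T * Y \<in> carrier_mat k r" using ortho_colsD[OF Vp] ortho_colsD[OF Y] by simp
  show ?thesis unfolding s
  proof (rule spectral_norm_mat_diag_le)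
    fix i assume i: "i < r"
    have "col W i \<in> carrier_vec r" "vec_norm2 (col W i) = 1"
      using W i ortho_colsD(1)[OF W] by (auto simp: ortho_cols_iff vec_norm2_def)
    then show "\<bar>vec_norm2 ((Vp\<^sup>T * Y) *\<^sub>v col W i)\<bar> \<le> spectral_norm (Vp\<^sup>T * Y)"
      using vec_norm2_mult_le_spectral[OF Q, of "col W i"] by simp
  qed simp
qed

lemma frob_norm_sin_Theta_le:
  assumes V: "V \<in> ortho_cols p r" and Vp: "Vp \<in> ortho_cols p k"
    and compl: "V * V\<^sup>T + Vp * Vp\<^sup>T = 1\<^sub>m p" and Y: "Y \<in> ortho_cols p r"
  shows "frob_norm (sin_Theta V Y) \<le> frob_norm (Vp\<^sup>T * Y)"
proof -
  obtain W where W: "W \<in> ortho_cols r r"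
    and s: "sin_Theta V Y = mat_diag r (\<lambda>i. vec_norm2 ((Vp\<^sup>T * Y) *\<^sub>v col W i))"
    using sin_Theta_eq_norms[OF assms] by blast
  have Q: "Vp\<^sup>T * Y \<in> carrier_mat k r" using ortho_colsD[OF Vp] ortho_colsD[OF Y] by simp
  note Wc = ortho_colsD[OF W]
  have "(frob_norm (sin_Theta V Y))\<^sup>2 = (\<Sum>i<r. (vec_norm2 (col ((Vp\<^sup>T * Y) * W) i))\<^sup>2)"
    unfolding s frob_norm_mat_diag_sq by (intro sum.cong refl) (simp add: col_mult2[OF Q Wc(1)])
  also have "\<dots> = (frob_norm ((Vp\<^sup>T * Y) * W))\<^sup>2"
    using Wc by (simp add: frob_norm_sq_cols)
  finally have "frob_norm (sin_Theta V Y) = frob_norm ((Vp\<^sup>T * Y) * W)" by simp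
  also have "\<dots> \<le> frob_norm (Vp\<^sup>T * Y) * spectral_norm W"
    by (rule ideal_norm_mult_right[OF ideal_norm_frob Q Wc(1)])
  also have "\<dots> \<le> frob_norm (Vp\<^sup>T * Y) * 1"
    using spectral_norm_ortho_cols_le[OF W] by (intro mult_left_mono) auto
  finally show ?thesis by simp
qed

text \<open>The diagonal entries are sines, whatever the argument of the inverse cosine is.\<close>

lemma sin_Theta_trivial_bounds:
  assumes "V \<in> carrier_mat p r"
  shows "spectral_norm (sin_Theta V Y) \<le> 1" "frob_norm (sin_Theta V Y) \<le> sqrt (real r)"
proof -
  show "spectral_norm (sin_Theta V Y) \<le> 1"
    unfolding sin_Theta_def by (rule spectral_norm_mat_diag_le) auto
  have "(frob_norm (sin_Theta V Y))\<^sup>2 = (\<Sum>i<r. (sin (arccos (sing_val (V\<^sup>T * Y) (i + 1))))\<^sup>2)"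
    unfolding sin_Theta_def frob_norm_mat_diag_sq using assms by simp
  also have "\<dots> \<le> (\<Sum>i<r. 1)" by (intro sum_mono) (simp add: abs_square_le_1)
  finally have "(frob_norm (sin_Theta V Y))\<^sup>2 \<le> real r" by simp
  then show "frob_norm (sin_Theta V Y) \<le> sqrt (real r)" by (rule real_le_rsqrt)
qed

section \<open>Block form of the singular value decomposition\<close>

lemma mult_complement_eq:
  fixes M :: "real mat"
  assumes U: "U \<in> carrier_mat m r" and Up: "Up \<in> carrier_mat m k"
    and compl: "U * U\<^sup>T + Up * Up\<^sup>T = 1\<^sub>m m" and M: "M \<in> carrier_mat l m" and Y: "Y \<in> carrier_mat m q"
  shows "M * Y = (M * U) * (U\<^sup>T * Y) + (M * Up) * (Up\<^sup>T * Y)"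
proof -
  have c: "U * U\<^sup>T \<in> carrier_mat m m" "Up * Up\<^sup>T \<in> carrier_mat m m" using U Up by auto
  have aux: "(M * B) * (B\<^sup>T * Y) = M * ((B * B\<^sup>T) * Y)" if B: "B \<in> carrier_mat m s" for B :: "real mat" and s
  proof -
    have Bt: "B\<^sup>T \<in> carrier_mat s m" using B by simp
    have BtY: "B\<^sup>T * Y \<in> carrier_mat s q" using B Y by simp
    show ?thesis unfolding assoc_mult_mat[OF M B BtY] assoc_mult_mat[OF B Bt Y] ..
  qed
  have cY: "(U * U\<^sup>T) * Y \<in> carrier_mat m q" "(Up * Up\<^sup>T) * Y \<in> carrier_mat m q" using c Y by auto
  have "M * Y = M * ((U * U\<^sup>T + Up * Up\<^sup>T) * Y)" using compl Y by simp
  also have "\<dots> = M * ((U * U\<^sup>T) * Y) + M * ((Up * Up\<^sup>T) * Y)"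
    unfolding add_mult_distrib_mat[OF c Y] using mult_add_distrib_mat[OF M cY] .
  finally show ?thesis unfolding aux[OF U] aux[OF Up] .
qed

lemma append_cols_mult_append_rows:
  fixes A :: "real mat"
  assumes A: "A \<in> carrier_mat p r" and B: "B \<in> carrier_mat p k"
    and C: "C \<in> carrier_mat r q" and D: "D \<in> carrier_mat k q"
  shows "append_cols A B * (C @\<^sub>r D) = A * C + B * D"
proof -
  have "append_cols A B * (C @\<^sub>r D) =
      four_block_mat (A * C + B * D) (A * 0\<^sub>m r 0 + B * 0\<^sub>m k 0)
        (0\<^sub>m 0 r * C + 0\<^sub>m 0 k * D) (0\<^sub>m 0 r * 0\<^sub>m r 0 + 0\<^sub>m 0 k * 0\<^sub>m k 0)"
    unfolding append_cols_def append_rows_def carrier_matD[OF A] carrier_matD[OF B]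
      carrier_matD[OF C] carrier_matD[OF D]
    by (rule mult_four_block_mat[OF A B _ _ C _ D]) auto
  also have "\<dots> = A * C + B * D"
    by (rule eq_matI) (use A B C D in auto)
  finally show ?thesis .
qed

lemma transpose_append_cols:
  assumes A: "A \<in> carrier_mat p r" and B: "B \<in> carrier_mat p k"
  shows "(append_cols A B)\<^sup>T = A\<^sup>T @\<^sub>r B\<^sup>T"
  using A B unfolding append_cols_def append_rows_def by (intro eq_matI) auto

lemma ortho_cols_append_colsD:
  assumes U: "U \<in> carrier_mat p r" and Up: "Up \<in> carrier_mat p (p - r)" and r: "r \<le> p"
    and O: "append_cols U Up \<in> ortho_cols p p"
  shows "U \<in> ortho_cols p r" "Up \<in> ortho_cols p (p - r)"
    "U\<^sup>T * Up = 0\<^sub>m r (p - r)" "Up\<^sup>T * U = 0\<^sub>m (p - r) r"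
    "U * U\<^sup>T + Up * Up\<^sup>T = 1\<^sub>m p"
proof -
  let ?K = "append_cols U Up"
  have K: "?K \<in> carrier_mat p p" using ortho_colsD(1)[OF O] .
  have c1: "col ?K i = col U i" if "i < r" for i
    using that U Up r by (intro eq_vecI) (auto simp: append_cols_def)
  have c2: "col ?K (r + i) = col Up i" if "i < p - r" for i
    using that U Up r by (intro eq_vecI) (auto simp: append_cols_def)
  have dot: "col ?K i \<bullet> col ?K j = (if i = j then 1 else 0)" if "i < p" "j < p" for i j
    using O that by (auto simp: ortho_cols_iff)
  show "U \<in> ortho_cols p r"
    unfolding ortho_cols_iff
  proof (intro conjI allI impI U)
    fix i j assume "i < r" "j < r"
    then show "col U i \<bullet> col U j = (if i = j then 1 else 0)" using dot[of i j] c1 r by simp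
  qed
  show "Up \<in> ortho_cols p (p - r)"
    unfolding ortho_cols_iff
  proof (intro conjI allI impI Up)
    fix i j assume "i < p - r" "j < p - r"
    then show "col Up i \<bullet> col Up j = (if i = j then 1 else 0)" using dot[of "r + i" "r + j"] c2 r by simp
  qed
  have UUp: "col U i \<bullet> col Up j = 0" "col Up j \<bullet> col U i = 0" if "i < r" "j < p - r" for i j
    using dot[of i "r + j"] dot[of "r + j" i] c1 c2 that r by auto
  show "U\<^sup>T * Up = 0\<^sub>m r (p - r)" "Up\<^sup>T * U = 0\<^sub>m (p - r) r"
    by (rule eq_matI; use U Up UUp in simp)+
  have "?K * ?K\<^sup>T = U * U\<^sup>T + Up * Up\<^sup>T"
    unfolding transpose_append_cols[OF U Up]
    by (rule append_cols_mult_append_rows[OF U Up]) (use U Up in auto)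
  then show "U * U\<^sup>T + Up * Up\<^sup>T = 1\<^sub>m p" using ortho_cols_square[OF O] by simp
qed

lemma diag_block_mult_append_rows:
  fixes A :: "real mat"
  assumes A: "A \<in> carrier_mat a b" and D: "D \<in> carrier_mat c d"
    and C: "C \<in> carrier_mat b q" and E: "E \<in> carrier_mat d q"
  shows "four_block_mat A (0\<^sub>m a d) (0\<^sub>m c b) D * (C @\<^sub>r E) = (A * C) @\<^sub>r (D * E)"
proof -
  have "four_block_mat A (0\<^sub>m a d) (0\<^sub>m c b) D * (C @\<^sub>r E) =
     four_block_mat (A * C + 0\<^sub>m a d * E) (A * 0\<^sub>m b 0 + 0\<^sub>m a d * 0\<^sub>m d 0)
       (0\<^sub>m c b * C + D * E) (0\<^sub>m c b * 0\<^sub>m b 0 + D * 0\<^sub>m d 0)"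
    unfolding append_rows_def carrier_matD[OF C] carrier_matD[OF E]
    by (rule mult_four_block_mat[OF A _ _ D C _ E]) auto
  also have "\<dots> = (A * C) @\<^sub>r (D * E)"
    unfolding append_rows_def using A D C E by (intro cong_four_block_mat) auto
  finally show ?thesis .
qed

text \<open>The block form of a singular value decomposition, in terms of its two orthogonal splittings:
  \<open>X\<close> and its transpose map the leading subspaces into each other, and the off-diagonal blocks of \<open>X\<close> vanish.\<close>

lemma split_svdD:
  assumes svd: "split_svd p1 p2 r X U Up V Vp" and r: "r \<le> min p1 p2"
  defines "S \<equiv> mat_diag r (\<lambda>i. sing_val X (Suc i))"
  shows "X \<in> carrier_mat p1 p2"
    "U \<in> ortho_cols p1 r" "Up \<in> ortho_cols p1 (p1 - r)" "U * U\<^sup>T + Up * Up\<^sup>T = 1\<^sub>m p1"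
    "V \<in> ortho_cols p2 r" "Vp \<in> ortho_cols p2 (p2 - r)" "V * V\<^sup>T + Vp * Vp\<^sup>T = 1\<^sub>m p2"
    "X * V = U * S" "X\<^sup>T * U = V * S"
    "U\<^sup>T * X * Vp = 0\<^sub>m r (p2 - r)" "Up\<^sup>T * X * V = 0\<^sub>m (p1 - r) r"
proof -
  let ?D = "sing_block (p1 - r) (p2 - r) r X"
  note s = svd[unfolded split_svd_def]
  have X: "X \<in> carrier_mat p1 p2" and Uc: "U \<in> carrier_mat p1 r" and Upc: "Up \<in> carrier_mat p1 (p1 - r)"
    and Vc: "V \<in> carrier_mat p2 r" and Vpc: "Vp \<in> carrier_mat p2 (p2 - r)"
    and UO: "append_cols U Up \<in> ortho_cols p1 p1" and VO: "append_cols V Vp \<in> ortho_cols p2 p2"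
    and Xeq: "X = append_cols U Up *
         four_block_mat (sing_block r r 0 X) (0\<^sub>m r (p2 - r))
                        (0\<^sub>m (p1 - r) r) ?D * (V\<^sup>T @\<^sub>r Vp\<^sup>T)"
    using s by blast+
  have r1: "r \<le> p1" and r2: "r \<le> p2" using r by auto
  note U = ortho_cols_append_colsD[OF Uc Upc r1 UO] and V = ortho_cols_append_colsD[OF Vc Vpc r2 VO]
  show "X \<in> carrier_mat p1 p2" "U \<in> ortho_cols p1 r" "Up \<in> ortho_cols p1 (p1 - r)"
    "U * U\<^sup>T + Up * Up\<^sup>T = 1\<^sub>m p1" "V \<in> ortho_cols p2 r" "Vp \<in> ortho_cols p2 (p2 - r)"
    "V * V\<^sup>T + Vp * Vp\<^sup>T = 1\<^sub>m p2"
    by fact+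
  have S: "S \<in> carrier_mat r r" by (simp add: S_def)
  have D: "?D \<in> carrier_mat (p1 - r) (p2 - r)" by (simp add: sing_block_def)
  have SB: "sing_block r r 0 X = S" by (auto simp: sing_block_def S_def mat_diag_def)
  have St: "S\<^sup>T = S" by (auto simp: S_def mat_diag_def)
  have t: "U\<^sup>T \<in> carrier_mat r p1" "V\<^sup>T \<in> carrier_mat r p2" "Vp\<^sup>T \<in> carrier_mat (p2 - r) p2" "Up\<^sup>T \<in> carrier_mat (p1 - r) p1"
    using Uc Vc Vpc Upc by auto
  have SV: "S * V\<^sup>T \<in> carrier_mat r p2" and DV: "?D * Vp\<^sup>T \<in> carrier_mat (p1 - r) p2" using S D t by auto
  have UOc: "append_cols U Up \<in> carrier_mat p1 (r + (p1 - r))"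
    using ortho_colsD(1)[OF UO] r1 by simp
  have B: "four_block_mat S (0\<^sub>m r (p2 - r)) (0\<^sub>m (p1 - r) r) ?D \<in> carrier_mat (r + (p1 - r)) (r + (p2 - r))"
    using S D by simp
  have VV: "V\<^sup>T @\<^sub>r Vp\<^sup>T \<in> carrier_mat (r + (p2 - r)) p2" using t by auto
  have "X = append_cols U Up * ((S * V\<^sup>T) @\<^sub>r (?D * Vp\<^sup>T))"
    using Xeq unfolding SB assoc_mult_mat[OF UOc B VV] diag_block_mult_append_rows[OF S D t(2,3)] .
  also have "\<dots> = U * (S * V\<^sup>T) + Up * (?D * Vp\<^sup>T)"
    by (rule append_cols_mult_append_rows[OF Uc Upc SV DV])
  finally have Xs: "X = U * (S * V\<^sup>T) + Up * (?D * Vp\<^sup>T)" .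
  have right: "X * Y = U * (S * (V\<^sup>T * Y)) + Up * (?D * (Vp\<^sup>T * Y))" if Y: "Y \<in> carrier_mat p2 q" for Y :: "real mat" and q
  proof -
    have "X * Y = U * (S * V\<^sup>T) * Y + Up * (?D * Vp\<^sup>T) * Y"
      using Xs add_mult_distrib_mat[of "U * (S * V\<^sup>T)" p1 p2 "Up * (?D * Vp\<^sup>T)" Y q] Uc SV Upc DV Y by simp
    then show ?thesis
      unfolding assoc_mult_mat[OF Uc SV Y] assoc_mult_mat[OF Upc DV Y]
        assoc_mult_mat[OF S t(2) Y] assoc_mult_mat[OF D t(3) Y] .
  qed
  show XV: "X * V = U * S"
    using right[OF Vc] V(4) ortho_colsD(3)[OF V(1)] S D Uc Upc by simp
  have XVp: "X * Vp = Up * ?D"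
    using right[OF Vpc] V(3) ortho_colsD(3)[OF V(2)] S D Uc Upc by simp
  show "U\<^sup>T * X * Vp = 0\<^sub>m r (p2 - r)"
    unfolding assoc_mult_mat[OF t(1) X Vpc] XVp
    using assoc_mult_mat[OF t(1) Upc D] U(3) D by simp
  show "Up\<^sup>T * X * V = 0\<^sub>m (p1 - r) r"
    unfolding assoc_mult_mat[OF t(4) X Vc] XV
    using assoc_mult_mat[OF t(4) Uc S] U(4) S by simp
  have Xt: "X\<^sup>T \<in> carrier_mat p2 p1" using X by simp
  have "(S * V\<^sup>T)\<^sup>T = V * S" using transpose_mult[OF S t(2)] St by simp
  then have a1: "(U * (S * V\<^sup>T))\<^sup>T = V * S * U\<^sup>T" using transpose_mult[OF Uc SV] by simp
  have "(?D * Vp\<^sup>T)\<^sup>T = Vp * ?D\<^sup>T" using transpose_mult[OF D t(3)] by simp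
  then have a2: "(Up * (?D * Vp\<^sup>T))\<^sup>T = Vp * ?D\<^sup>T * Up\<^sup>T" using transpose_mult[OF Upc DV] by simp
  have cc: "U * (S * V\<^sup>T) \<in> carrier_mat p1 p2" "Up * (?D * Vp\<^sup>T) \<in> carrier_mat p1 p2"
    "V * S \<in> carrier_mat p2 r" "Vp * ?D\<^sup>T \<in> carrier_mat p2 (p1 - r)"
    "V * S * U\<^sup>T \<in> carrier_mat p2 p1" "Vp * ?D\<^sup>T * Up\<^sup>T \<in> carrier_mat p2 p1"
    using Uc SV Upc DV Vc S Vpc D t by auto
  have "X\<^sup>T = V * S * U\<^sup>T + Vp * ?D\<^sup>T * Up\<^sup>T"
    using arg_cong[OF Xs, of transpose_mat] transpose_add[OF cc(1,2)] a1 a2 by simp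
  then have "X\<^sup>T * U = V * S * U\<^sup>T * U + Vp * ?D\<^sup>T * Up\<^sup>T * U"
    using add_mult_distrib_mat[OF cc(5,6) Uc] by simp
  then show "X\<^sup>T * U = V * S"
    unfolding assoc_mult_mat[OF cc(3) t(1) Uc] assoc_mult_mat[OF cc(4) t(4) Uc]
    by (simp only: U(4) ortho_colsD(3)[OF U(1)] right_mult_one_mat[OF cc(3)]
        right_mult_zero_mat[OF cc(4)] right_add_zero_mat[OF cc(3)])
qed

section \<open>The perturbation argument\<close>

lemma ideal_norm_compress_le:
  assumes N: "ideal_norm N" and A: "A \<in> carrier_mat m n"
    and U: "U \<in> ortho_cols m k" and V: "V \<in> ortho_cols n l"
  shows "N (U\<^sup>T * A * V) \<le> N A"
proof -
  note Uc = ortho_colsD[OF U] and Vc = ortho_colsD[OF V]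
  have UA: "U\<^sup>T * A \<in> carrier_mat k n" using Uc A by simp
  have "N (U\<^sup>T * A * V) \<le> N (U\<^sup>T * A) * spectral_norm V"
    by (rule ideal_norm_mult_right[OF N UA Vc(1)])
  also have "\<dots> \<le> N (U\<^sup>T * A) * 1"
    using spectral_norm_ortho_cols_le[OF V] ideal_normD(1)[OF N] by (intro mult_left_mono) auto
  also have "N (U\<^sup>T * A) \<le> spectral_norm U\<^sup>T * N A"
    by (rule ideal_normD(4)[OF N Uc(2) A])
  also have "\<dots> \<le> 1 * N A"
    using spectral_norm_ortho_cols_le[OF U] ideal_normD(1)[OF N] by (intro mult_right_mono) auto
  finally show ?thesis by simp
qed

lemma ideal_norm_mult_diag_ge:
  assumes N: "ideal_norm N" and Q: "Q \<in> carrier_mat k r"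
    and s: "\<And>i. i < r \<Longrightarrow> \<alpha> \<le> s i" and \<alpha>: "0 < \<alpha>"
  shows "\<alpha> * N Q \<le> N (Q * mat_diag r s)"
proof -
  have pos: "0 < s i" if "i < r" for i using s[OF that] \<alpha> by simp
  \<comment> \<open>Undo the multiplication: the inverse diagonal matrix has norm at most \<open>1 / \<alpha>\<close>.\<close>
  have "mat_diag r (\<lambda>i. s i * inverse (s i)) = 1\<^sub>m r"
  proof (rule eq_matI)
    fix i j assume "i < dim_row (1\<^sub>m r :: real mat)" "j < dim_col (1\<^sub>m r :: real mat)"
    then show "mat_diag r (\<lambda>i. s i * inverse (s i)) $$ (i, j) = 1\<^sub>m r $$ (i, j)"
      using pos[of j] by (simp add: mat_diag_def)
  qed (simp_all add: mat_diag_def)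
  then have "Q = Q * mat_diag r s * mat_diag r (\<lambda>i. inverse (s i))"
    using assoc_mult_mat[OF Q mat_diag_dim mat_diag_dim, of s "\<lambda>i. inverse (s i)"] Q by simp
  then have "N Q \<le> N (Q * mat_diag r s) * spectral_norm (mat_diag r (\<lambda>i. inverse (s i)))"
    using ideal_norm_mult_right[OF N mult_carrier_mat[OF Q mat_diag_dim] mat_diag_dim] by metis
  also have "\<dots> \<le> N (Q * mat_diag r s) * inverse \<alpha>"
  proof (rule mult_left_mono)
    show "spectral_norm (mat_diag r (\<lambda>i. inverse (s i))) \<le> inverse \<alpha>"
    proof (rule spectral_norm_mat_diag_le)
      fix i assume i: "i < r"
      show "\<bar>inverse (s i)\<bar> \<le> inverse \<alpha>"
        using le_imp_inverse_le[OF s[OF i] \<alpha>] pos[OF i] by simp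
    qed (use \<alpha> in simp)
  qed (rule ideal_normD(1)[OF N])
  finally show ?thesis using \<alpha> by (simp add: field_simps)
qed

text \<open>Put \<open>S = mat_diag r s\<close> and insert \<open>1 = U U\<^sup>T + Up Up\<^sup>T\<close> between \<open>A\<^sup>T\<close> and \<open>Y\<close> in
  \<open>Vp\<^sup>T W S = Vp\<^sup>T A\<^sup>T Y\<close>. This gives
  \<open>Vp\<^sup>T W S = (U\<^sup>T A Vp)\<^sup>T (U\<^sup>T Y) + (Up\<^sup>T A Vp)\<^sup>T (Up\<^sup>T Y)\<close>. On the left, multiplication by \<open>S\<close> multiplies
  the norm by at least \<open>\<alpha>\<close>; on the right, \<open>U\<^sup>T Y\<close> is a contraction. The result bounds the sines
  on the \<open>V\<close> side by those on the \<open>U\<close> side.\<close>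

lemma sine_coupling_inequality:
  assumes N: "ideal_norm N" and A: "A \<in> carrier_mat m n"
    and U: "U \<in> ortho_cols m r" and Up: "Up \<in> ortho_cols m k" and Uc: "U * U\<^sup>T + Up * Up\<^sup>T = 1\<^sub>m m"
    and Vp: "Vp \<in> ortho_cols n l"
    and Y: "Y \<in> ortho_cols m r" and W: "W \<in> ortho_cols n r"
    and AY: "A\<^sup>T * Y = W * mat_diag r s"
    and s: "\<And>i. i < r \<Longrightarrow> \<alpha> \<le> s i" and \<alpha>: "0 < \<alpha>"
  shows "\<alpha> * N (Vp\<^sup>T * W) \<le> N (U\<^sup>T * A * Vp) + spectral_norm (Up\<^sup>T * A * Vp) * N (Up\<^sup>T * Y)"
proof -
  note cU = ortho_colsD[OF U] and cUp = ortho_colsD[OF Up] and cVp = ortho_colsD[OF Vp]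
    and cY = ortho_colsD[OF Y] and cW = ortho_colsD[OF W]
  have At: "A\<^sup>T \<in> carrier_mat n m" using A by simp
  have VA: "Vp\<^sup>T * A\<^sup>T \<in> carrier_mat l m" using cVp At by simp
  have tr: "Vp\<^sup>T * A\<^sup>T * B = (B\<^sup>T * A * Vp)\<^sup>T" if B: "B \<in> carrier_mat m q" for B :: "real mat" and q
  proof -
    have Bt: "B\<^sup>T \<in> carrier_mat q m" using B by simp
    have "(B\<^sup>T * A * Vp)\<^sup>T = Vp\<^sup>T * (A\<^sup>T * B)"
      using transpose_mult[OF mult_carrier_mat[OF Bt A] cVp(1)] transpose_mult[OF Bt A] by simp
    then show ?thesis using assoc_mult_mat[OF cVp(2) At B] by simp
  qed
  have E: "U\<^sup>T * A * Vp \<in> carrier_mat r l" "Up\<^sup>T * A * Vp \<in> carrier_mat k l"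
    and UY: "U\<^sup>T * Y \<in> carrier_mat r r" "Up\<^sup>T * Y \<in> carrier_mat k r"
    and Q: "Vp\<^sup>T * W \<in> carrier_mat l r"
    using cU cUp cVp cY cW A by auto
  have Et: "(U\<^sup>T * A * Vp)\<^sup>T \<in> carrier_mat l r" "(Up\<^sup>T * A * Vp)\<^sup>T \<in> carrier_mat l k"
    using E by simp_all
  have "(Vp\<^sup>T * W) * mat_diag r s = Vp\<^sup>T * A\<^sup>T * Y"
    unfolding assoc_mult_mat[OF cVp(2) cW(1) mat_diag_dim] assoc_mult_mat[OF cVp(2) At cY(1)] AY ..
  also have "\<dots> = (U\<^sup>T * A * Vp)\<^sup>T * (U\<^sup>T * Y) + (Up\<^sup>T * A * Vp)\<^sup>T * (Up\<^sup>T * Y)"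
    using mult_complement_eq[OF cU(1) cUp(1) Uc VA cY(1)] unfolding tr[OF cU(1)] tr[OF cUp(1)] .
  finally have eq: "(Vp\<^sup>T * W) * mat_diag r s =
      (U\<^sup>T * A * Vp)\<^sup>T * (U\<^sup>T * Y) + (Up\<^sup>T * A * Vp)\<^sup>T * (Up\<^sup>T * Y)" .
  have "\<alpha> * N (Vp\<^sup>T * W) \<le> N ((Vp\<^sup>T * W) * mat_diag r s)"
    by (rule ideal_norm_mult_diag_ge[OF N Q s \<alpha>])
  also have "\<dots> \<le> N ((U\<^sup>T * A * Vp)\<^sup>T * (U\<^sup>T * Y)) + N ((Up\<^sup>T * A * Vp)\<^sup>T * (Up\<^sup>T * Y))"
    unfolding eq by (rule ideal_normD(3)[OF N mult_carrier_mat[OF Et(1) UY(1)] mult_carrier_mat[OF Et(2) UY(2)]])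
  also have "N ((U\<^sup>T * A * Vp)\<^sup>T * (U\<^sup>T * Y)) \<le> N (U\<^sup>T * A * Vp)"
  proof -
    have Ec: "(U\<^sup>T * A * Vp)\<^sup>T * U\<^sup>T \<in> carrier_mat l m" using Et cU by simp
    have "N ((U\<^sup>T * A * Vp)\<^sup>T * (U\<^sup>T * Y)) \<le> N ((U\<^sup>T * A * Vp)\<^sup>T) * spectral_norm (U\<^sup>T * Y)"
      by (rule ideal_norm_mult_right[OF N Et(1) UY(1)])
    also have "\<dots> \<le> N ((U\<^sup>T * A * Vp)\<^sup>T) * 1"
    proof (rule mult_left_mono)
      have "spectral_norm (U\<^sup>T * Y) \<le> spectral_norm U\<^sup>T * spectral_norm Y"
        by (rule ideal_normD(4)[OF ideal_norm_spectral cU(2) cY(1)])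
      also have "\<dots> \<le> 1 * 1"
        using spectral_norm_ortho_cols_le[OF U] spectral_norm_ortho_cols_le[OF Y]
        by (intro mult_mono) auto
      finally show "spectral_norm (U\<^sup>T * Y) \<le> 1" by simp
    qed (rule ideal_normD(1)[OF N])
    finally show ?thesis by (simp add: ideal_normD(2)[OF N])
  qed
  also have "N ((Up\<^sup>T * A * Vp)\<^sup>T * (Up\<^sup>T * Y)) \<le> spectral_norm (Up\<^sup>T * A * Vp) * N (Up\<^sup>T * Y)"
    using ideal_normD(4)[OF N Et(2) UY(2)] by (simp add: ideal_normD(2)[OF ideal_norm_spectral])
  finally show ?thesis by simp
qed

text \<open>The coupling inequality for \<open>A\<close> and for \<open>A\<^sup>T\<close> gives \<open>\<alpha> q \<le> a + \<beta> t\<close> and \<open>\<alpha> t \<le> b + \<beta> q\<close>, where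
  \<open>q\<close> and \<open>t\<close> are the norms of \<open>Vp\<^sup>T W\<close> and \<open>Up\<^sup>T Y\<close>. Eliminating either unknown bounds the other.\<close>

lemma sine_bounds_ideal_norm:
  assumes N: "ideal_norm N" and A: "A \<in> carrier_mat m n"
    and U: "U \<in> ortho_cols m r" and Up: "Up \<in> ortho_cols m k" and Uc: "U * U\<^sup>T + Up * Up\<^sup>T = 1\<^sub>m m"
    and V: "V \<in> ortho_cols n r" and Vp: "Vp \<in> ortho_cols n l" and Vc: "V * V\<^sup>T + Vp * Vp\<^sup>T = 1\<^sub>m n"
    and Y: "Y \<in> ortho_cols m r" and W: "W \<in> ortho_cols n r"
    and AW: "A * W = Y * mat_diag r s" and AY: "A\<^sup>T * Y = W * mat_diag r s"
    and s: "\<And>i. i < r \<Longrightarrow> \<alpha> \<le> s i" and \<alpha>: "0 < \<alpha>"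
    and a: "N (U\<^sup>T * A * Vp) \<le> a" and b: "N (Up\<^sup>T * A * V) \<le> b"
    and \<beta>: "spectral_norm (Up\<^sup>T * A * Vp) = \<beta>"
  shows "(\<alpha>\<^sup>2 - \<beta>\<^sup>2) * N (Vp\<^sup>T * W) \<le> \<alpha> * a + \<beta> * b"
    "(\<alpha>\<^sup>2 - \<beta>\<^sup>2) * N (Up\<^sup>T * Y) \<le> \<alpha> * b + \<beta> * a"
proof -
  note cU = ortho_colsD[OF U] and cUp = ortho_colsD[OF Up] and cV = ortho_colsD[OF V] and cVp = ortho_colsD[OF Vp]
  define q where "q = N (Vp\<^sup>T * W)"
  define t where "t = N (Up\<^sup>T * Y)"
  have \<beta>0: "0 \<le> \<beta>" using \<beta> spectral_norm_nonneg by metis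
  have At: "A\<^sup>T \<in> carrier_mat n m" using A by simp
  have tr: "B\<^sup>T * A\<^sup>T * Up = (Up\<^sup>T * A * B)\<^sup>T" if B: "B \<in> carrier_mat n c" for B :: "real mat" and c
  proof -
    have Bt: "B\<^sup>T \<in> carrier_mat c n" using B by simp
    have "(Up\<^sup>T * A * B)\<^sup>T = B\<^sup>T * (A\<^sup>T * Up)"
      using transpose_mult[OF mult_carrier_mat[OF cUp(2) A] B] transpose_mult[OF cUp(2) A] by simp
    then show ?thesis using assoc_mult_mat[OF Bt At cUp(1)] by simp
  qed
  have "\<alpha> * q \<le> N (U\<^sup>T * A * Vp) + \<beta> * t"
    using sine_coupling_inequality[OF N A U Up Uc Vp Y W AY s \<alpha>] by (simp add: q_def t_def \<beta>)
  then have 1: "\<alpha> * q \<le> a + \<beta> * t" using a by simp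
  have "\<alpha> * t \<le> N (V\<^sup>T * A\<^sup>T * Up) + spectral_norm (Vp\<^sup>T * A\<^sup>T * Up) * q"
    using sine_coupling_inequality[OF N At V Vp Vc Up W Y _ s \<alpha>] AW by (simp add: q_def t_def)
  then have "\<alpha> * t \<le> N (Up\<^sup>T * A * V) + \<beta> * q"
    by (simp add: tr[OF cV(1)] tr[OF cVp(1)] ideal_normD(2)[OF N] ideal_normD(2)[OF ideal_norm_spectral] \<beta>)
  then have 2: "\<alpha> * t \<le> b + \<beta> * q" using b by simp
  have "\<alpha> * (\<alpha> * q) \<le> \<alpha> * a + \<beta> * (\<alpha> * t)"
    using mult_left_mono[OF 1, of \<alpha>] \<alpha> by (simp add: algebra_simps)
  also have "\<dots> \<le> \<alpha> * a + \<beta> * (b + \<beta> * q)" using mult_left_mono[OF 2 \<beta>0] by simp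
  finally show "(\<alpha>\<^sup>2 - \<beta>\<^sup>2) * N (Vp\<^sup>T * W) \<le> \<alpha> * a + \<beta> * b"
    by (simp add: q_def power2_eq_square algebra_simps)
  have "\<alpha> * (\<alpha> * t) \<le> \<alpha> * b + \<beta> * (\<alpha> * q)"
    using mult_left_mono[OF 2, of \<alpha>] \<alpha> by (simp add: algebra_simps)
  also have "\<dots> \<le> \<alpha> * b + \<beta> * (a + \<beta> * t)" using mult_left_mono[OF 1 \<beta>0] by simp
  finally show "(\<alpha>\<^sup>2 - \<beta>\<^sup>2) * N (Up\<^sup>T * Y) \<le> \<alpha> * b + \<beta> * a"
    by (simp add: t_def power2_eq_square algebra_simps)
qed

text \<open>The unperturbed \<open>X\<close> has no off-diagonal block, so that this block of \<open>X + Z\<close> is that of \<open>Z\<close>,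
  and it is a compression of the projected perturbation.\<close>

lemma ideal_norm_off_diagonal_block_le:
  assumes N: "ideal_norm N" and X: "X \<in> carrier_mat m n" and Z: "Z \<in> carrier_mat m n"
    and U: "U \<in> ortho_cols m k" and V: "V \<in> ortho_cols n l"
    and zero: "U\<^sup>T * X * V = 0\<^sub>m k l"
  shows "N (U\<^sup>T * (X + Z) * V) \<le> N (col_space_proj U * Z * col_space_proj V)"
proof -
  note cU = ortho_colsD[OF U] and cV = ortho_colsD[OF V]
  have c: "U\<^sup>T * X \<in> carrier_mat k n" "U\<^sup>T * Z \<in> carrier_mat k n" "U\<^sup>T * Z * V \<in> carrier_mat k l"
    "U * U\<^sup>T \<in> carrier_mat m m" "V * V\<^sup>T \<in> carrier_mat n n" "U * U\<^sup>T * Z \<in> carrier_mat m n"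
    "U * U\<^sup>T * Z * (V * V\<^sup>T) \<in> carrier_mat m n" "V * V\<^sup>T * V \<in> carrier_mat n l"
    using X Z cU cV by auto
  have "U\<^sup>T * (X + Z) * V = U\<^sup>T * Z * V"
    unfolding mult_add_distrib_mat[OF cU(2) X Z] add_mult_distrib_mat[OF c(1,2) cV(1)] zero
    using c by simp
  moreover have "U\<^sup>T * (U * U\<^sup>T * Z * (V * V\<^sup>T)) * V = U\<^sup>T * Z * V"
  proof -
    have "U\<^sup>T * (U * U\<^sup>T * Z * (V * V\<^sup>T)) * V = U\<^sup>T * (U * U\<^sup>T * Z * (V * V\<^sup>T) * V)"
      by (rule assoc_mult_mat[OF cU(2) c(7) cV(1)])
    also have "U * U\<^sup>T * Z * (V * V\<^sup>T) * V = U * U\<^sup>T * Z * (V * V\<^sup>T * V)"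
      by (rule assoc_mult_mat[OF c(6,5) cV(1)])
    also have "V * V\<^sup>T * V = V" using assoc_mult_mat[OF cV(1,2,1)] cV by simp
    also have "U * U\<^sup>T * Z * V = U * (U\<^sup>T * Z * V)"
      unfolding assoc_mult_mat[OF cU(1,2) Z] assoc_mult_mat[OF cU(1) c(2) cV(1)] ..
    also have "U\<^sup>T * \<dots> = U\<^sup>T * Z * V"
      by (simp only: assoc_mult_mat[OF cU(2,1) c(3), symmetric] cU(3) left_mult_one_mat[OF c(3)])
    finally show ?thesis .
  qed
  ultimately show ?thesis
    using ideal_norm_compress_le[OF N c(7) U V]
    by (simp add: col_space_proj_ortho_cols[OF U] col_space_proj_ortho_cols[OF V])
qed

theorem theorem1:
  fixes X Z Xhat U Uperp V Vperp Uhat Uhatperp Vhat Vhatperp Z12 Z21 :: "real mat"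
    and p1 p2 r :: nat
    and z12 z21 \<alpha> \<beta> :: real
  assumes "X \<in> carrier_mat p1 p2" and "Z \<in> carrier_mat p1 p2"
    and "Xhat = X + Z"
    and "1 \<le> r" and "r \<le> min p1 p2"
    and "split_svd p1 p2 r X U Uperp V Vperp"
    and "split_svd p1 p2 r Xhat Uhat Uhatperp Vhat Vhatperp"
    and "Z12 = col_space_proj U * Z * col_space_proj Vperp"
    and "Z21 = col_space_proj Uperp * Z * col_space_proj V"
    and "z12 = spectral_norm Z12"
    and "z21 = spectral_norm Z21"
    and "\<alpha> = sing_val_min (transpose_mat U * Xhat * V)"
    and "\<beta> = spectral_norm (transpose_mat Uperp * Xhat * Vperp)"
    and "\<alpha>\<^sup>2 > \<beta>\<^sup>2 + min (z12\<^sup>2) (z21\<^sup>2)"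
  shows "spectral_norm (sin_Theta V Vhat)
           \<le> min ((\<alpha> * z12 + \<beta> * z21) / (\<alpha>\<^sup>2 - \<beta>\<^sup>2 - min (z21\<^sup>2) (z12\<^sup>2))) 1
       \<and> frob_norm (sin_Theta V Vhat)
           \<le> min ((\<alpha> * frob_norm Z12 + \<beta> * frob_norm Z21) / (\<alpha>\<^sup>2 - \<beta>\<^sup>2 - min (z21\<^sup>2) (z12\<^sup>2))) (sqrt (real r))
       \<and> spectral_norm (sin_Theta U Uhat)
           \<le> min ((\<alpha> * z21 + \<beta> * z12) / (\<alpha>\<^sup>2 - \<beta>\<^sup>2 - min (z21\<^sup>2) (z12\<^sup>2))) 1
       \<and> frob_norm (sin_Theta U Uhat)
           \<le> min ((\<alpha> * frob_norm Z21 + \<beta> * frob_norm Z12) / (\<alpha>\<^sup>2 - \<beta>\<^sup>2 - min (z21\<^sup>2) (z12\<^sup>2))) (sqrt (real r))"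
proof -
  note r = assms(4,5)
  note S = split_svdD[OF assms(6) r(2)] and Sh = split_svdD[OF assms(7) r(2)]
  note Xh = Sh(1) and U = S(2) and Up = S(3) and Uc = S(4) and V = S(5) and Vp = S(6) and Vc = S(7)
  have M: "U\<^sup>T * Xhat * V \<in> carrier_mat r r"
    using Xh ortho_colsD[OF U] ortho_colsD[OF V] by auto
  have \<alpha>: "\<alpha> = sing_val (U\<^sup>T * Xhat * V) r"
    unfolding assms(12) sing_val_min_def carrier_matD[OF M] by simp
  have "0 \<le> \<alpha>" unfolding \<alpha> by (rule sing_val_nonneg[OF M]) (use r in auto)
  have gap: "0 < \<alpha>\<^sup>2 - \<beta>\<^sup>2 - min (z21\<^sup>2) (z12\<^sup>2)" using assms(14) by (simp add: min.commute)
  have m0: "0 \<le> min (z21\<^sup>2) (z12\<^sup>2)" by simp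
  have "\<alpha>\<^sup>2 > 0" using gap m0 zero_le_power2[of \<beta>] by linarith
  then have \<alpha>0: "0 < \<alpha>" using \<open>0 \<le> \<alpha>\<close> by (simp add: less_le)
  have \<beta>0: "0 \<le> \<beta>" using assms(13) by simp
  have s: "\<alpha> \<le> sing_val Xhat (Suc i)" if "i < r" for i
  proof -
    have "\<alpha> \<le> sing_val Xhat r" unfolding \<alpha> by (rule sing_val_compression_le[OF Xh U V r])
    also have "\<dots> \<le> sing_val Xhat (Suc i)"
      by (rule sing_val_antimono[OF Xh]) (use that r in auto)
    finally show ?thesis .
  qed
  have bounds: "N (Vperp\<^sup>T * Vhat) \<le> (\<alpha> * N Z12 + \<beta> * N Z21) / (\<alpha>\<^sup>2 - \<beta>\<^sup>2 - min (z21\<^sup>2) (z12\<^sup>2))"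
      "N (Uperp\<^sup>T * Uhat) \<le> (\<alpha> * N Z21 + \<beta> * N Z12) / (\<alpha>\<^sup>2 - \<beta>\<^sup>2 - min (z21\<^sup>2) (z12\<^sup>2))"
    if N: "ideal_norm N" for N
  proof -
    have a: "N (U\<^sup>T * Xhat * Vperp) \<le> N Z12"
      unfolding assms(3,8) by (rule ideal_norm_off_diagonal_block_le[OF N assms(1,2) U Vp S(10)])
    have b: "N (Uperp\<^sup>T * Xhat * V) \<le> N Z21"
      unfolding assms(3,9) by (rule ideal_norm_off_diagonal_block_le[OF N assms(1,2) Up V S(11)])
    note w = sine_bounds_ideal_norm[OF N Xh U Up Uc V Vp Vc Sh(2,5,8,9) s \<alpha>0 a b assms(13)[symmetric]]
    \<comment> \<open>Subtracting the minimum does not enlarge the denominator and leaves it positive.\<close>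
    have div: "q \<le> c / (\<alpha>\<^sup>2 - \<beta>\<^sup>2 - min (z21\<^sup>2) (z12\<^sup>2))"
      if "(\<alpha>\<^sup>2 - \<beta>\<^sup>2) * q \<le> c" "0 \<le> q" for q c
    proof -
      have "q * (\<alpha>\<^sup>2 - \<beta>\<^sup>2 - min (z21\<^sup>2) (z12\<^sup>2)) \<le> q * (\<alpha>\<^sup>2 - \<beta>\<^sup>2)"
        using that m0 by (intro mult_left_mono) auto
      also have "\<dots> \<le> c" using that by (simp add: mult.commute)
      finally show ?thesis using gap by (simp add: pos_le_divide_eq)
    qed
    show "N (Vperp\<^sup>T * Vhat) \<le> (\<alpha> * N Z12 + \<beta> * N Z21) / (\<alpha>\<^sup>2 - \<beta>\<^sup>2 - min (z21\<^sup>2) (z12\<^sup>2))"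
      by (rule div[OF w(1) ideal_normD(1)[OF N]])
    show "N (Uperp\<^sup>T * Uhat) \<le> (\<alpha> * N Z21 + \<beta> * N Z12) / (\<alpha>\<^sup>2 - \<beta>\<^sup>2 - min (z21\<^sup>2) (z12\<^sup>2))"
      by (rule div[OF w(2) ideal_normD(1)[OF N]])
  qed
  note sp = bounds[OF ideal_norm_spectral, folded assms(10,11)] and fr = bounds[OF ideal_norm_frob]
  note tV = sin_Theta_trivial_bounds[OF ortho_colsD(1)[OF V], of Vhat]
    and tU = sin_Theta_trivial_bounds[OF ortho_colsD(1)[OF U], of Uhat]
  show ?thesis
    using order_trans[OF spectral_norm_sin_Theta_le[OF V Vp Vc Sh(5)] sp(1)]
      order_trans[OF frob_norm_sin_Theta_le[OF V Vp Vc Sh(5)] fr(1)]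
      order_trans[OF spectral_norm_sin_Theta_le[OF U Up Uc Sh(2)] sp(2)]
      order_trans[OF frob_norm_sin_Theta_le[OF U Up Uc Sh(2)] fr(2)] tV tU
    by (intro conjI min.boundedI)
qed

end
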